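(* Let $T=(T,[\cdot,\ldots,\cdot],\epsilon,\alpha)$ be a multiplicative $n$-ary $Hom$-$\Omega$ color algebra over a field $\mathbb F$. Let $\breve T=Tt+Tt^n$ with its multiplication and twisting map $\breve\alpha$ (defined in the context), and let $U$ be a $\mathbb G$-graded subspace of $T$ with $T=U\oplus[T,\ldots,T]$, so that $\breve T=Tt+Ut^n+[T,\ldots,T]t^n$. Define $$\varphi:{\rm QDer}(T)\to{\rm End}(\breve T),\qquad \varphi(D)(at+ut^n+bt^n)=D(a)t+D'(b)t^n\quad(a\in T,\ u\in U,\ b\in[T,\ldots,T]),$$ where $D\in{\rm QDer}(T)$ and $D'$ is a map related to $D$ by the definition of quasiderivation. Then: (1) $\varphi$ is even; (2) $\varphi$ is injective, and $\varphi(D)$ does not depend on the choice of $D'$; (3) $\varphi({\rm QDer}(T))\subseteq{\rm Der}(\breve T)$.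
   Context: Setting. $\mathbb F$ is a field, $\mathbb G$ an (additive) abelian group, and $\epsilon:\mathbb G\times\mathbb G\to\mathbb F^*$ is a bicharacter: $\epsilon(f,g+h)=\epsilon(f,g)\epsilon(f,h)$, $\epsilon(g+h,f)=\epsilon(g,f)\epsilon(h,f)$, $\epsilon(g,h)\epsilon(h,g)=1$. A color $n$-ary algebra is a $\mathbb G$-graded vector space $T=\bigoplus_{g\in\mathbb G}T_g$ over $\mathbb F$ with an $n$-linear map $[\cdot,\ldots,\cdot]$ such that $[T_{\theta_1},\ldots,T_{\theta_n}]\subseteq T_{\theta_1+\cdots+\theta_n}$. For $x\in T_g$ write $hg(x)=g$. A linear map $D$ is homogeneous of degree $\xi$ if $D(T_g)\subseteq T_{g+\xi}$ for all $g$; ${\rm End}_\xi(T)$ is the space of these, ${\rm End}(T)=\bigoplus_\xi{\rm End}_\xi(T)$; a map of degree $0$ is called even (for $\varphi$: it sends maps of degree $\xi$ to maps of degree $\xi$). Elements and maps are assumed homogeneous unless stated otherwise. $\epsilon(a,b)$ means $\epsilon(hg(a),hg(b))$ for homogeneous elements or maps (and likewise when an argument is already an element of $\mathbb G$). For $x_1,\ldots,x_n$ put $X_i=hg(x_1)+\cdots+hg(x_i)$, $X_0=0$. $[T,\ldots,T]$ denotes the linear span of all products. Multiplicative $n$-ary $Hom$-$\Omega$ color algebra. It is a color $n$-ary algebra $T$ with an even linear map $\alpha:T\to T$ satisfying $\alpha([x_1,\ldots,x_n])=[\alpha(x_1),\ldots,\alpha(x_n)]$, and satisfying the identities $f^{Hom}_{co}=0$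 for all $f$ in a given (arbitrary) family $\Omega$ of $n$-ary multilinear polynomials. Here, if $f=\sum_{\beta,\sigma}a_{\beta,\sigma}[x_{\sigma(i_1)}\ldots x_{\sigma(i_m)}]_\beta$ ($\beta$ an arrangement of brackets, $\sigma\in S_m$, $i_1,\ldots,i_m$ a fixed reference order of the letters), then $f_{co}=\sum_{\beta,\sigma}a_{\beta,\sigma}\epsilon_\sigma[x_{\sigma(i_1)}\ldots x_{\sigma(i_m)}]_\beta$, where $\epsilon_\sigma$ is the product of the factors $\epsilon(x_j,x_{j'})$ picked up when the reference order is transformed into the order of the word by successively replacing adjacent letters $x_jx_{j'}$ by $x_{j'}x_j$; and $f^{Hom}_{co}$ is obtained from $f_{co}$ by replacing, in each word, each letter $x_j$ lying inside exactly $d$ nested brackets by $\alpha^{M-d}(x_j)$, where $M$ is the maximal nesting depth occurring in $f$. Standing convention on maps. Only linear maps commuting with the twisting map are considered, i.e. maps in $S=\{u\in{\rm End}(T):u\alpha=\alpha u\}$ (and, for $\breve T$, maps commuting with $\breve\alpha$). Derivations and quasiderivations. For an integer $k\ge0$, $D\in{\rm End}_\xi(T)$ is a homogeneous $\alpha^k$-derivation if $$D([x_1,\ldots,x_n])=\sum_{i=1}^n\epsilon(D,X_{i-1})[\alpha^k(x_1),\ldots,\alpha^k(x_{i-1}),D(x_i),\alpha^k(x_{i+1}),\ldots,\alpha^k(x_n)]$$ for all $x_i$; it is a homogeneous $\alpha^k$-quasiderivation if there is $D'\in{\rm End}_\xi(T)$ with $$\sum_{i=1}^n\epsilon(D,X_{i-1})[\alpha^k(x_1),\ldots,\alpha^k(x_{i-1}),D(x_i),\alpha^k(x_{i+1}),\ldots,\alpha^k(x_n)]=D'([x_1,\ldots,x_n])$$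 for all $x_i$. ${\rm Der}_{\alpha^k}(T)$ and ${\rm QDer}_{\alpha^k}(T)$ are the sets of these maps, ${\rm Der}(T)=\bigoplus_{k\ge0}{\rm Der}_{\alpha^k}(T)$ and ${\rm QDer}(T)=\bigoplus_{k\ge0}{\rm QDer}_{\alpha^k}(T)$. The same definitions apply to $(\breve T,\breve\alpha)$. The algebra $\breve T$. Let $t$ be an indeterminate; $\breve T=\{\sum(x\otimes t+y\otimes t^n): x,y\in T\}$, with $xt,xt^n$ written for $x\otimes t,x\otimes t^n$, graded by $\breve T_g=T_gt+T_gt^n$, with multiplication $[x_1t^{i_1},\ldots,x_nt^{i_n}]=[x_1,\ldots,x_n]t^{i_1+\cdots+i_n}$ for $i_j\in\{1,n\}$, where $t^m=0$ for $m>n$, and twisting map $\breve\alpha(xt+yt^n)=\alpha(x)t+\alpha(y)t^n$. It is again a multiplicative $n$-ary $Hom$-$\Omega$ color algebra.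
   Formalization: (3) is proved for Der without commutation with the twist of T-breve; with it, if all values of φ commute (e.g. α(U)⊆U). The sum over k in QDer(T) is external, so φ is injective as to underlying linear maps and on each QDer_{α^k}(T). n≥2. *)

theory Defs
  imports "HOL.Vector_Spaces" "HOL-Library.Multiset" "HOL-Library.Product_Plus" "HOL-Library.Poly_Mapping"
begin

section \<open>Color n-ary algebras with a twisting map\<close>

text \<open>The vector space is the whole type \<open>'a\<close>. The bracket takes a list and is only
  ever applied to lists of length \<open>arity\<close>.\<close>

record ('f, 'g, 'a) hom_color =
  smul :: "'f \<Rightarrow> 'a \<Rightarrow> 'a"
  arity :: nat
  bichar :: "'g \<Rightarrow> 'g \<Rightarrow> 'f"
  hcomp :: "'g \<Rightarrow> 'a set"
  brac :: "'a list \<Rightarrow> 'a"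
  twist :: "'a \<Rightarrow> 'a"

definition bicharacter :: "('g::ab_group_add \<Rightarrow> 'g \<Rightarrow> 'f::field) \<Rightarrow> bool" where
  "bicharacter e \<longleftrightarrow>
     (\<forall>g h. e g h \<noteq> 0) \<and>
     (\<forall>f g h. e f (g + h) = e f g * e f h) \<and>
     (\<forall>f g h. e (g + h) f = e g f * e h f) \<and>
     (\<forall>g h. e g h * e h g = 1)"

definition graded_space :: "('f::field, 'g::ab_group_add, 'a::ab_group_add) hom_color \<Rightarrow> bool" where
  "graded_space T \<longleftrightarrow>
     vector_space (smul T) \<and>
     (\<forall>g. module.subspace (smul T) (hcomp T g)) \<and>
     (\<forall>x. \<exists>!c. (\<forall>g. c g \<in> hcomp T g) \<and> finite {g. c g \<noteq> 0} \<and> x = (\<Sum>g | c g \<noteq> 0. c g))"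

definition homogeneous_args ::
  "('f::field, 'g::ab_group_add, 'a::ab_group_add) hom_color \<Rightarrow> 'a list \<Rightarrow> 'g list \<Rightarrow> bool" where
  "homogeneous_args T xs gs \<longleftrightarrow>
     length xs = arity T \<and> length gs = arity T \<and> (\<forall>i < arity T. xs ! i \<in> hcomp T (gs ! i))"

definition color_algebra :: "('f::field, 'g::ab_group_add, 'a::ab_group_add) hom_color \<Rightarrow> bool" where
  "color_algebra T \<longleftrightarrow>
     bicharacter (bichar T) \<and> graded_space T \<and>
     (\<forall>xs ys. length xs + length ys + 1 = arity T \<longrightarrow>
        Vector_Spaces.linear (smul T) (smul T) (\<lambda>x. brac T (xs @ x # ys))) \<and>
     (\<forall>xs gs. homogeneous_args T xs gs \<longrightarrow> brac T xs \<in> hcomp T (sum_list gs))"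

definition products_span :: "('f::field, 'g, 'a::ab_group_add) hom_color \<Rightarrow> 'a set" where
  "products_span T = module.span (smul T) {brac T xs |xs. length xs = arity T}"


section \<open>Finite sums of linear maps\<close>

definition sum_map :: "('i \<Rightarrow> 'a \<Rightarrow> 'b::comm_monoid_add) \<Rightarrow> 'a \<Rightarrow> 'b" where
  "sum_map F = (\<lambda>x. \<Sum>i | F i \<noteq> (\<lambda>_. 0). F i x)"

definition finsupp :: "('i \<Rightarrow> 'a \<Rightarrow> 'b::zero) \<Rightarrow> bool" where
  "finsupp F \<longleftrightarrow> finite {i. F i \<noteq> (\<lambda>_. 0)}"

definition dsum :: "('i \<Rightarrow> ('a \<Rightarrow> 'b::zero) set) \<Rightarrow> ('i \<Rightarrow> 'a \<Rightarrow> 'b) set" where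
  "dsum A = {F. (\<forall>i. F i \<in> A i) \<and> finsupp F}"

definition Endo_deg ::
  "('f::field, 'g::ab_group_add, 'a::ab_group_add) hom_color \<Rightarrow> 'g \<Rightarrow> ('a \<Rightarrow> 'a) set" where
  "Endo_deg T \<xi> =
     {D. Vector_Spaces.linear (smul T) (smul T) D \<and> (\<forall>g. D ` hcomp T g \<subseteq> hcomp T (g + \<xi>))}"

definition Endo ::
  "('f::field, 'g::ab_group_add, 'a::ab_group_add) hom_color \<Rightarrow> ('a \<Rightarrow> 'a) set" where
  "Endo T = sum_map ` dsum (Endo_deg T)"

definition Comm ::
  "('f::field, 'g::ab_group_add, 'a::ab_group_add) hom_color \<Rightarrow> ('a \<Rightarrow> 'a) set" where
  "Comm T = {u \<in> Endo T. u \<circ> twist T = twist T \<circ> u}"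


section \<open>Multilinear polynomials and Hom-Omega color algebras\<close>

datatype bword = Letter nat | Bracket "bword list"

fun nary :: "nat \<Rightarrow> bword \<Rightarrow> bool" where
  "nary n (Letter j) = True"
| "nary n (Bracket ws) = (length ws = n \<and> (\<forall>w \<in> set ws. nary n w))"

fun letters :: "bword \<Rightarrow> nat list" where
  "letters (Letter j) = [j]"
| "letters (Bracket ws) = concat (map letters ws)"

fun depth :: "bword \<Rightarrow> nat" where
  "depth (Letter j) = 0"
| "depth (Bracket ws) = Suc (Max (insert 0 (depth ` set ws)))"

text \<open>A polynomial is a finitely supported combination of bracketed words, together with the
  reference order of its letters.\<close>

type_synonym 'f hpoly = "nat list \<times> (bword \<Rightarrow>\<^sub>0 'f)"

definition multilinear_poly :: "nat \<Rightarrow> ('f::field) hpoly \<Rightarrow> bool" where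
  "multilinear_poly n p \<longleftrightarrow>
     distinct (fst p) \<and>
     (\<forall>w \<in> Poly_Mapping.keys (snd p). nary n w \<and> mset (letters w) = mset (fst p))"

definition max_depth :: "('f::zero) hpoly \<Rightarrow> nat" where
  "max_depth p = Max (insert 0 (depth ` Poly_Mapping.keys (snd p)))"

text \<open>\<open>reorder e h r s c\<close>: the word \<open>r\<close> can be turned into \<open>s\<close> by successive transpositions of
  adjacent letters, picking up the product \<open>c\<close>; \<open>h\<close> gives the degrees of the letters.\<close>

inductive reorder ::
  "('g \<Rightarrow> 'g \<Rightarrow> 'f::field) \<Rightarrow> (nat \<Rightarrow> 'g) \<Rightarrow> nat list \<Rightarrow> nat list \<Rightarrow> 'f \<Rightarrow> bool"
  for e :: "'g \<Rightarrow> 'g \<Rightarrow> 'f::field" and h :: "nat \<Rightarrow> 'g" and r :: "nat list"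
where
  refl: "reorder e h r r 1"
| swap: "reorder e h r (us @ a # b # vs) c \<Longrightarrow>
         reorder e h r (us @ b # a # vs) (c * e (h a) (h b))"

definition eps_sigma ::
  "('g \<Rightarrow> 'g \<Rightarrow> 'f::field) \<Rightarrow> (nat \<Rightarrow> 'g) \<Rightarrow> nat list \<Rightarrow> nat list \<Rightarrow> 'f" where
  "eps_sigma e h r s = (THE c. reorder e h r s c)"

text \<open>Started with exponent \<open>M\<close>, this evaluates a letter inside \<open>d\<close> brackets
  at \<open>\<alpha>\<^sup>M\<^sup>-\<^sup>d (x j)\<close>.\<close>

fun eval_word ::
  "('f, 'g, 'a) hom_color \<Rightarrow> (nat \<Rightarrow> 'a) \<Rightarrow> nat \<Rightarrow> bword \<Rightarrow> 'a" where
  "eval_word T x m (Letter j) = (twist T ^^ m) (x j)"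
| "eval_word T x m (Bracket ws) = brac T (map (eval_word T x (m - 1)) ws)"

definition satisfies_hom_co ::
  "('f::field, 'g::ab_group_add, 'a::ab_group_add) hom_color \<Rightarrow> 'f hpoly \<Rightarrow> bool" where
  "satisfies_hom_co T p \<longleftrightarrow>
     (\<forall>x h. (\<forall>j \<in> set (fst p). x j \<in> hcomp T (h j)) \<longrightarrow>
        (\<Sum>w \<in> Poly_Mapping.keys (snd p).
           smul T (Poly_Mapping.lookup (snd p) w * eps_sigma (bichar T) h (fst p) (letters w))
             (eval_word T x (max_depth p) w)) = 0)"

definition hom_omega_color_algebra ::
  "'f hpoly set \<Rightarrow> ('f::field, 'g::ab_group_add, 'a::ab_group_add) hom_color \<Rightarrow> bool" where
  "hom_omega_color_algebra \<Omega> T \<longleftrightarrow>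
     color_algebra T \<and>
     twist T \<in> Endo_deg T 0 \<and>
     (\<forall>xs. length xs = arity T \<longrightarrow> twist T (brac T xs) = brac T (map (twist T) xs)) \<and>
     (\<forall>p \<in> \<Omega>. multilinear_poly (arity T) p \<and> satisfies_hom_co T p)"


section \<open>Derivations and quasiderivations\<close>

text \<open>The sum on the derivation side, for a map \<open>D\<close> of degree \<open>\<xi>\<close> and arguments of
  degrees \<open>gs\<close> (indices start at 0).\<close>

definition leibniz_sum ::
  "('f::field, 'g::ab_group_add, 'a::ab_group_add) hom_color \<Rightarrow> nat \<Rightarrow> 'g \<Rightarrow> ('a \<Rightarrow> 'a)
     \<Rightarrow> 'a list \<Rightarrow> 'g list \<Rightarrow> 'a" where
  "leibniz_sum T k \<xi> D xs gs =
     (\<Sum>i < arity T. smul T (bichar T \<xi> (sum_list (take i gs)))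
        (brac T ((map (twist T ^^ k) xs)[i := D (xs ! i)])))"

text \<open>The parameter \<open>V\<close> is the set of maps taken into consideration: \<open>UNIV\<close>, or \<open>Comm T\<close>
  if only maps commuting with the twisting map are considered.\<close>

definition Der_hom ::
  "('a \<Rightarrow> 'a) set \<Rightarrow> ('f::field, 'g::ab_group_add, 'a::ab_group_add) hom_color
     \<Rightarrow> nat \<Rightarrow> 'g \<Rightarrow> ('a \<Rightarrow> 'a) set" where
  "Der_hom V T k \<xi> =
     {D \<in> Endo_deg T \<xi> \<inter> V.
        \<forall>xs gs. homogeneous_args T xs gs \<longrightarrow> D (brac T xs) = leibniz_sum T k \<xi> D xs gs}"

definition Der_k ::
  "('a \<Rightarrow> 'a) set \<Rightarrow> ('f::field, 'g::ab_group_add, 'a::ab_group_add) hom_color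
     \<Rightarrow> nat \<Rightarrow> ('a \<Rightarrow> 'a) set" where
  "Der_k V T k = sum_map ` dsum (Der_hom V T k)"

definition Der ::
  "('a \<Rightarrow> 'a) set \<Rightarrow> ('f::field, 'g::ab_group_add, 'a::ab_group_add) hom_color
     \<Rightarrow> ('a \<Rightarrow> 'a) set" where
  "Der V T = sum_map ` dsum (Der_k V T)"

definition quasi_pair_hom ::
  "('f::field, 'g::ab_group_add, 'a::ab_group_add) hom_color \<Rightarrow> nat \<Rightarrow> 'g
     \<Rightarrow> ('a \<Rightarrow> 'a) \<Rightarrow> ('a \<Rightarrow> 'a) \<Rightarrow> bool" where
  "quasi_pair_hom T k \<xi> D D' \<longleftrightarrow>
     D \<in> Endo_deg T \<xi> \<inter> Comm T \<and> D' \<in> Endo_deg T \<xi> \<inter> Comm T \<and>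
     (\<forall>xs gs. homogeneous_args T xs gs \<longrightarrow> leibniz_sum T k \<xi> D xs gs = D' (brac T xs))"

definition QDer_hom ::
  "('f::field, 'g::ab_group_add, 'a::ab_group_add) hom_color \<Rightarrow> nat \<Rightarrow> 'g \<Rightarrow> ('a \<Rightarrow> 'a) set" where
  "QDer_hom T k \<xi> = {D. \<exists>D'. quasi_pair_hom T k \<xi> D D'}"

definition QDer_k ::
  "('f::field, 'g::ab_group_add, 'a::ab_group_add) hom_color \<Rightarrow> nat \<Rightarrow> ('a \<Rightarrow> 'a) set" where
  "QDer_k T k = sum_map ` dsum (QDer_hom T k)"

text \<open>The subspaces \<open>QDer_k T k\<close> of \<open>Endo T\<close> need not be independent (take \<open>\<alpha> = id\<close>), and the
  values of \<open>D'\<close> on products depend on \<open>k\<close> and not only on the map \<open>D\<close> (take \<open>\<alpha> = 0\<close>,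
  \<open>D = id\<close>, \<open>k \<in> {0, 1}\<close>). Hence the elements of the direct sum over \<open>k\<close> are finitely
  supported families; the underlying linear map of a family \<open>D\<close> is \<open>sum_map D\<close>.\<close>

definition QDer ::
  "('f::field, 'g::ab_group_add, 'a::ab_group_add) hom_color \<Rightarrow> (nat \<Rightarrow> 'a \<Rightarrow> 'a) set" where
  "QDer T = dsum (QDer_k T)"

definition QDer_at ::
  "('f::field, 'g::ab_group_add, 'a::ab_group_add) hom_color \<Rightarrow> nat \<Rightarrow> (nat \<Rightarrow> 'a \<Rightarrow> 'a) set" where
  "QDer_at T k = {D \<in> QDer T. \<forall>j. j \<noteq> k \<longrightarrow> D j = (\<lambda>_. 0)}"

definition quasi_pair_k ::
  "('f::field, 'g::ab_group_add, 'a::ab_group_add) hom_color \<Rightarrow> nat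
     \<Rightarrow> ('a \<Rightarrow> 'a) \<Rightarrow> ('a \<Rightarrow> 'a) \<Rightarrow> bool" where
  "quasi_pair_k T k D D' \<longleftrightarrow>
     (\<exists>F F'. finsupp F \<and> finsupp F' \<and> (\<forall>\<xi>. quasi_pair_hom T k \<xi> (F \<xi>) (F' \<xi>)) \<and>
        D = sum_map F \<and> D' = sum_map F')"

definition quasi_pair ::
  "('f::field, 'g::ab_group_add, 'a::ab_group_add) hom_color
     \<Rightarrow> (nat \<Rightarrow> 'a \<Rightarrow> 'a) \<Rightarrow> (nat \<Rightarrow> 'a \<Rightarrow> 'a) \<Rightarrow> bool" where
  "quasi_pair T D D' \<longleftrightarrow> finsupp D \<and> finsupp D' \<and> (\<forall>k. quasi_pair_k T k (D k) (D' k))"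


section \<open>The algebra T t + T t^n\<close>

text \<open>The pair \<open>(x, y)\<close> stands for \<open>x t + y t\<^sup>n\<close>.\<close>

definition tmonom :: "nat \<Rightarrow> 'a \<Rightarrow> nat \<Rightarrow> 'a::zero \<times> 'a" where
  "tmonom n x m = (if m = 1 then (x, 0) else if m = n then (0, x) else (0, 0))"

definition tcoeff :: "nat \<Rightarrow> 'a \<times> 'a \<Rightarrow> 'a" where
  "tcoeff i p = (if i = 1 then fst p else snd p)"

text \<open>The bracket is the multilinear extension of the rule for monomials: expand over all
  choices of exponents in \<open>{1, n}\<close>. Exponents strictly between 1 and \<open>n\<close> do not occur, as
  a sum of \<open>n\<close> exponents is at least \<open>n\<close>.\<close>

definition breve ::
  "('f::field, 'g::ab_group_add, 'a::ab_group_add) hom_color \<Rightarrow> ('f, 'g, 'a \<times> 'a) hom_color" where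
  "breve T =
     \<lparr>smul = (\<lambda>c (x, y). (smul T c x, smul T c y)),
      arity = arity T,
      bichar = bichar T,
      hcomp = (\<lambda>g. hcomp T g \<times> hcomp T g),
      brac = (\<lambda>ps. \<Sum>es | length es = arity T \<and> set es \<subseteq> {1, arity T}.
                tmonom (arity T) (brac T (map2 tcoeff es ps)) (sum_list es)),
      twist = (\<lambda>(x, y). (twist T x, twist T y))\<rparr>"


section \<open>The map phi\<close>

definition graded_subspace ::
  "('f::field, 'g::ab_group_add, 'a::ab_group_add) hom_color \<Rightarrow> 'a set \<Rightarrow> bool" where
  "graded_subspace T U \<longleftrightarrow>
     module.subspace (smul T) U \<and>
     (\<forall>u \<in> U. \<exists>c. (\<forall>g. c g \<in> U \<inter> hcomp T g) \<and> finite {g. c g \<noteq> 0} \<and> u = (\<Sum>g | c g \<noteq> 0. c g))"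

definition complement_of_products ::
  "('f::field, 'g::ab_group_add, 'a::ab_group_add) hom_color \<Rightarrow> 'a set \<Rightarrow> bool" where
  "complement_of_products T U \<longleftrightarrow>
     U \<inter> products_span T = {0} \<and> (\<forall>x. \<exists>u \<in> U. \<exists>b \<in> products_span T. x = u + b)"

definition phi_via ::
  "('f::field, 'g::ab_group_add, 'a::ab_group_add) hom_color \<Rightarrow> 'a set
     \<Rightarrow> ('a \<Rightarrow> 'a) \<Rightarrow> ('a \<Rightarrow> 'a) \<Rightarrow> 'a \<times> 'a \<Rightarrow> 'a \<times> 'a" where
  "phi_via T U D D' = (\<lambda>(a, y). (D a, D' (THE b. b \<in> products_span T \<and> (\<exists>u \<in> U. y = u + b))))"

definition phi ::
  "('f::field, 'g::ab_group_add, 'a::ab_group_add) hom_color \<Rightarrow> 'a set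
     \<Rightarrow> (nat \<Rightarrow> 'a \<Rightarrow> 'a) \<Rightarrow> 'a \<times> 'a \<Rightarrow> 'a \<times> 'a" where
  "phi T U D = phi_via T U (sum_map D) (sum_map (SOME D'. quasi_pair T D D'))"


section \<open>Consistency of the definitions\<close>

lemma reorder_mset: "reorder e h r s c \<Longrightarrow> mset s = mset r"
  by (induction rule: reorder.induct) (auto simp: add_mset_commute)

lemma reorder_exists:
  assumes "mset s = mset r"
  shows "\<exists>c. reorder e h r s c"
proof -
  have move: "\<exists>c'. reorder e h r (us @ x # vs @ ws) c'"
    if "reorder e h r (us @ vs @ x # ws) c" for us vs ws x c
    using that
  proof (induction vs arbitrary: ws c rule: rev_induct)
    case (snoc v vs)
    then have "reorder e h r ((us @ vs) @ v # x # ws) c" by simp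
    from reorder.swap[OF this] show ?case using snoc.IH[of "v # ws"] by simp
  qed auto
  have "\<exists>c. reorder e h r (s1 @ s') c" if "s = s1 @ s2" "mset s' = mset s2" for s1 s2 s'
    using that
  proof (induction s1 arbitrary: s2 s' rule: rev_induct)
    case Nil
    then show ?case
    proof -
      have "\<exists>c. reorder e h r (p @ q) c"
        if "\<exists>c. reorder e h r (p @ q') c" "mset q = mset q'" for p q q'
        using that
      proof (induction q arbitrary: p q')
        case (Cons x q)
        then have "x \<in> set q'" by (metis list.set_intros(1) mset_eq_setD)
        then obtain vs ws where q': "q' = vs @ x # ws" by (meson split_list)
        with Cons.prems have "mset q = mset (vs @ ws)" by simp
        moreover have "\<exists>c. reorder e h r ((p @ [x]) @ vs @ ws) c"
          using Cons.prems(1) move q' by fastforce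
        ultimately show ?case using Cons.IH[of "p @ [x]" "vs @ ws"] by simp
      qed simp
      from this[of "[]" r s'] show ?thesis
        using Nil assms reorder.refl[of e h r] by auto
    qed
  next
    case (snoc x s1)
    then show ?case using snoc.IH[of "x # s2" "x # s'"] by simp
  qed
  from this[of s "[]" "[]"] show ?thesis by simp
qed

lemma reorder_unique:
  fixes e :: "'g::ab_group_add \<Rightarrow> 'g \<Rightarrow> 'f::field"
  assumes e: "bicharacter e" and r: "distinct r"
    and "reorder e h r s c" "reorder e h r s c'"
  shows "c = c'"
proof -
  define p where "p = the_inv_into {..<length r} ((!) r)"
  have inj: "inj_on ((!) r) {..<length r}" using r by (simp add: inj_on_nth)
  have p: "p (r ! i) = i" if "i < length r" for i
    unfolding p_def using the_inv_into_f_f[OF inj] that by simp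
  have p_inj: "p a \<noteq> p b" if "a \<in> set r" "b \<in> set r" "a \<noteq> b" for a b
    using that p by (metis in_set_conv_nth)
  have srt: "sorted_wrt (\<lambda>a b. p a < p b) r"
    by (simp add: sorted_wrt_iff_nth_less p)
  define F where "F a b = (if p b < p a then e (h b) (h a) else 1)" for a b
  define P where "P = rec_list 1 (\<lambda>a as q. prod_list (map (F a) as) * q)"
  have P_Nil: "P [] = 1" and P_Cons: "P (a # as) = prod_list (map (F a) as) * P as" for a as
    by (simp_all add: P_def)
  have Pr: "P s = 1" if "sorted_wrt (\<lambda>a b. p a < p b) s" for s
    using that
  proof (induction s)
    case (Cons a s)
    have "prod_list (map (F a) s) = prod_list (map (\<lambda>_. 1) s)"
      using Cons.prems by (intro arg_cong[where f = prod_list] map_cong) (auto simp: F_def)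
    then show ?case using Cons by (simp add: P_Cons map_replicate_const)
  qed (simp add: P_Nil)
  have sw: "P (us @ b # a # vs) = P (us @ a # b # vs) * e (h a) (h b)"
    if "p a \<noteq> p b" for us vs a b
  proof (induction us)
    case Nil
    have "e (h b) (h a) * e (h a) (h b) = 1" using e by (simp add: bicharacter_def)
    then have "F b a = F a b * e (h a) (h b)" using that by (auto simp: F_def)
    then show ?case by (simp add: P_Cons)
  qed (simp add: P_Cons mult_ac)
  have "c = P s" if "reorder e h r s c" for s c
    using that
  proof (induction rule: reorder.induct)
    case (swap us a b vs c)
    have m: "mset (us @ a # b # vs) = mset r" using swap.hyps by (rule reorder_mset)
    then have "distinct (us @ a # b # vs)" "set (us @ a # b # vs) = set r"
      using r by (metis mset_eq_imp_distinct_iff, metis mset_eq_setD)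
    then have "p a \<noteq> p b" by (intro p_inj) auto
    from sw[OF this, of us vs] show ?case by (simp only: swap.IH)
  qed (simp add: Pr srt)
  from this[OF assms(3)] this[OF assms(4)] show ?thesis by simp
qed

lemma eps_sigma_eqI:
  fixes e :: "'g::ab_group_add \<Rightarrow> 'g \<Rightarrow> 'f::field"
  assumes "bicharacter e" "distinct r" "reorder e h r s c"
  shows "eps_sigma e h r s = c"
  unfolding eps_sigma_def
  by (rule the_equality, rule assms(3)) (rule reorder_unique[OF assms(1,2) _ assms(3)])

lemma brac_breve:
  assumes "2 \<le> arity T" "length ps = arity T"
  shows "brac (breve T) ps = (0, brac T (map fst ps))"
proof -
  let ?n = "arity T"
  let ?I = "{es. length es = ?n \<and> set es \<subseteq> {1, ?n}}"
  let ?f = "\<lambda>es. tmonom ?n (brac T (map2 tcoeff es ps)) (sum_list es)"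
  let ?o = "replicate ?n (1::nat)"
  have fin: "finite ?I"
    using finite_lists_length_eq[of "{1, ?n}" ?n] by (simp add: conj_commute)
  have low: "length es \<le> sum_list es" if "set es \<subseteq> {1, ?n}" for es :: "nat list"
    using that assms(1) by (induction es) auto
  have big: "?n < sum_list es" if "es \<in> ?I" "es \<noteq> ?o" for es
  proof -
    have "\<exists>i \<in> set es. i \<noteq> 1" using that by (metis (mono_tags, lifting) mem_Collect_eq replicate_length_same)
    then have "?n \<in> set es" using that by auto
    then obtain as bs where es: "es = as @ ?n # bs" by (meson split_list)
    then have "length as \<le> sum_list as" "length bs \<le> sum_list bs"
      using that low by auto
    then show ?thesis using that es assms(1) by auto
  qed
  have "(\<Sum>es\<in>?I. ?f es) = (\<Sum>es\<in>{?o}. ?f es)"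
    using fin assms(1) big by (intro sum.mono_neutral_right) (fastforce simp: tmonom_def zero_prod_def)+
  also have "map2 tcoeff ?o ps = map fst ps"
    using assms(2) by (intro nth_equalityI) (auto simp: tcoeff_def)
  then have "(\<Sum>es\<in>{?o}. ?f es) = (0, brac T (map fst ps))"
    using assms(1) by (simp add: tmonom_def sum_list_replicate)
  finally show ?thesis by (simp add: breve_def)
qed

end

theory Submission
  imports Defs
begin

text \<open>The product of \<open>T t + T t\<^sup>n\<close> has values in \<open>[T,\<dots>,T] t\<^sup>n\<close> and depends only on the
  \<open>t\<close>-parts of its arguments, so the derivation identity for \<open>\<phi>(D)\<close> is the quasiderivation
  identity for \<open>(D, D')\<close>. As \<open>[T,\<dots>,T]\<close> is spanned by products of homogeneous elements,
  that identity determines \<open>D'\<close> on \<open>[T,\<dots>,T]\<close>, the only part of \<open>T\<close> on which \<open>\<phi>(D)\<close>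
  uses it. The projection onto \<open>[T,\<dots>,T]\<close> along \<open>U\<close> is even because both summands are
  graded. Maps that are not homogeneous are split into their homogeneous components, which they
  determine uniquely.\<close>

section \<open>Homogeneous components\<close>

text \<open>Uniqueness in \<open>graded_space\<close> concerns whole families, so \<open>THE\<close>
  picks the family of homogeneous parts of \<open>x\<close>, which is then evaluated at
  \<open>g\<close>.\<close>

definition component ::
  "('f::field, 'g::ab_group_add, 'a::ab_group_add) hom_color \<Rightarrow> 'g \<Rightarrow> 'a \<Rightarrow> 'a" where
  "component T g x =
     (THE c. (\<forall>g. c g \<in> hcomp T g) \<and> finite {g. c g \<noteq> 0} \<and> x = (\<Sum>g | c g \<noteq> 0. c g)) g"

locale graded =
  fixes T :: "('f::field, 'g::ab_group_add, 'a::ab_group_add) hom_color"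
  assumes graded: "graded_space T"
begin

sublocale vector_space "smul T"
  using graded by (simp add: graded_space_def)

lemma hcomp_subspace: "subspace (hcomp T g)"
  using graded by (simp add: graded_space_def)

lemma ex1_component:
  "\<exists>!c. (\<forall>g. c g \<in> hcomp T g) \<and> finite {g. c g \<noteq> 0} \<and> x = (\<Sum>g | c g \<noteq> 0. c g)"
  using graded by (simp add: graded_space_def)

lemma
  component_in: "component T g x \<in> hcomp T g" and
  finite_component: "finite {g. component T g x \<noteq> 0}" and
  component_sum: "x = (\<Sum>g | component T g x \<noteq> 0. component T g x)"
  using theI'[OF ex1_component[of x]] by (auto simp: component_def)

text \<open>Uniqueness of the decomposition. The sum may run over any finite set containing the
  support, so exact supports, for instance of a sum of two families, need not be computed.\<close>

lemma component_eqI: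
  assumes "\<And>g. c g \<in> hcomp T g" "finite S" "\<And>g. g \<notin> S \<Longrightarrow> c g = 0" "x = sum c S"
  shows "component T g x = c g"
proof -
  have sub: "{g. c g \<noteq> 0} \<subseteq> S"
    using assms(3) by auto
  then have "sum c S = (\<Sum>g | c g \<noteq> 0. c g)"
    using assms(2) by (intro sum.mono_neutral_right) auto
  then have "(THE c. (\<forall>g. c g \<in> hcomp T g) \<and> finite {g. c g \<noteq> 0} \<and> x = (\<Sum>g | c g \<noteq> 0. c g)) = c"
    using assms sub by (intro the1_equality[OF ex1_component]) (auto intro: finite_subset)
  then show ?thesis
    by (simp add: component_def)
qed

lemma component_sum_superset:
  assumes "finite S" "\<And>g. g \<notin> S \<Longrightarrow> component T g x = 0"
  shows "x = (\<Sum>g\<in>S. component T g x)"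
proof -
  have "(\<Sum>g\<in>S. component T g x) = (\<Sum>g | component T g x \<noteq> 0. component T g x)"
    using assms by (intro sum.mono_neutral_right) auto
  then show ?thesis
    using component_sum[of x, symmetric] by simp
qed

lemma component_homogeneous:
  "x \<in> hcomp T g \<Longrightarrow> component T h x = (if h = g then x else 0)"
  using subspace_0[OF hcomp_subspace]
  by (intro component_eqI[where S = "{g}" and c = "\<lambda>h. if h = g then x else 0"]) auto

section \<open>Linear maps of a fixed degree\<close>

lemma Endo_degI:
  assumes "\<And>x y. D (x + y) = D x + D y" "\<And>a x. D (smul T a x) = smul T a (D x)"
    "\<And>g x. x \<in> hcomp T g \<Longrightarrow> D x \<in> hcomp T (g + \<xi>)"
  shows "D \<in> Endo_deg T \<xi>"
  using assms vector_space_axioms by (auto simp: Endo_deg_def linear_iff)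

lemma
  assumes "D \<in> Endo_deg T \<xi>"
  shows Endo_deg_add: "D (x + y) = D x + D y"
    and Endo_deg_scale: "D (smul T a x) = smul T a (D x)"
    and Endo_deg_hcomp: "x \<in> hcomp T g \<Longrightarrow> D x \<in> hcomp T (g + \<xi>)"
  using assms by (auto simp: Endo_deg_def linear_iff image_subset_iff)

lemma Endo_deg_0: "D \<in> Endo_deg T \<xi> \<Longrightarrow> D 0 = 0"
  using Endo_deg_add[of D \<xi> 0 0] by simp

lemma Endo_deg_sum: "D \<in> Endo_deg T \<xi> \<Longrightarrow> D (\<Sum>i\<in>I. f i) = (\<Sum>i\<in>I. D (f i))"
  by (induction I rule: infinite_finite_induct) (auto simp: Endo_deg_0 Endo_deg_add)

text \<open>Decompositions of \<open>x\<close> and \<open>y\<close>, written over the union of their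
  supports, add up to one of \<open>x + y\<close>. Taking parts is thus an even map, and the rules
  for \<open>Endo_deg\<close> apply to it.\<close>

lemma component_in_Endo_deg: "component T g \<in> Endo_deg T 0"
proof (rule Endo_degI)
  fix x y
  let ?S = "{g. component T g x \<noteq> 0} \<union> {g. component T g y \<noteq> 0}"
  have "x = (\<Sum>g\<in>?S. component T g x)" "y = (\<Sum>g\<in>?S. component T g y)"
    by (intro component_sum_superset; simp add: finite_component)+
  then have "x + y = (\<Sum>g\<in>?S. component T g x + component T g y)"
    by (simp add: sum.distrib)
  then show "component T g (x + y) = component T g x + component T g y"
    by (intro component_eqI[where S = ?S])
      (auto simp: finite_component component_in intro: subspace_add[OF hcomp_subspace])
next
  fix a x
  show "component T g (smul T a x) = smul T a (component T g x)"
    by (intro component_eqI[where S = "{g. component T g x \<noteq> 0}"])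
      (auto simp: finite_component component_in scale_sum_right[symmetric] component_sum[symmetric]
        intro: subspace_scale[OF hcomp_subspace])
next
  fix h x
  assume "x \<in> hcomp T h"
  then show "component T g x \<in> hcomp T (h + 0)"
    using subspace_0[OF hcomp_subspace] by (simp add: component_homogeneous)
qed

text \<open>Reduces the claim that a map sends a span into a subspace to the generators of the
  span.\<close>

lemma subspace_Endo_deg_vimage:
  assumes "D \<in> Endo_deg T \<xi>" "subspace A"
  shows "subspace {x. D x \<in> A}"
  using assms(2) unfolding subspace_def
  by (simp add: Endo_deg_0[OF assms(1)] Endo_deg_add[OF assms(1)] Endo_deg_scale[OF assms(1)])

text \<open>A decomposition of \<open>u\<close> inside \<open>U\<close> is also one inside
  \<open>T\<close>, hence the only one.\<close>

lemma graded_subspace_component: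
  assumes "graded_subspace T U" "u \<in> U"
  shows "component T g u \<in> U"
proof -
  obtain c where c: "\<forall>g. c g \<in> U \<inter> hcomp T g" "finite {g. c g \<noteq> 0}" "u = (\<Sum>g | c g \<noteq> 0. c g)"
    using assms unfolding graded_subspace_def by blast
  then have "component T g u = c g"
    by (intro component_eqI[where S = "{g. c g \<noteq> 0}"]) auto
  then show ?thesis
    using c(1) by simp
qed

lemma zero_in_Endo_deg: "(\<lambda>_. 0) \<in> Endo_deg T \<xi>"
  by (rule Endo_degI) (auto intro: subspace_0[OF hcomp_subspace])

lemma sum_in_Endo_deg:
  assumes "\<And>i. i \<in> I \<Longrightarrow> F i \<in> Endo_deg T \<xi>"
  shows "(\<lambda>x. \<Sum>i\<in>I. F i x) \<in> Endo_deg T \<xi>"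
proof (rule Endo_degI)
  show "(\<Sum>i\<in>I. F i (x + y)) = (\<Sum>i\<in>I. F i x) + (\<Sum>i\<in>I. F i y)" for x y
    unfolding sum.distrib[symmetric] using Endo_deg_add[OF assms] by (intro sum.cong) auto
  show "(\<Sum>i\<in>I. F i (smul T a x)) = smul T a (\<Sum>i\<in>I. F i x)" for a x
    unfolding scale_sum_right using Endo_deg_scale[OF assms] by (intro sum.cong) auto
  show "(\<Sum>i\<in>I. F i x) \<in> hcomp T (g + \<xi>)" if "x \<in> hcomp T g" for g x
    using Endo_deg_hcomp[OF assms that] by (intro subspace_sum[OF hcomp_subspace])
qed

lemma comp_in_Endo_deg:
  assumes "D \<in> Endo_deg T \<xi>" "E \<in> Endo_deg T \<eta>"
  shows "D \<circ> E \<in> Endo_deg T (\<xi> + \<eta>)"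
proof (rule Endo_degI)
  fix g x
  assume "x \<in> hcomp T g"
  then have "D (E x) \<in> hcomp T (g + \<eta> + \<xi>)"
    by (intro Endo_deg_hcomp[OF assms(1)] Endo_deg_hcomp[OF assms(2)])
  then show "(D \<circ> E) x \<in> hcomp T (g + (\<xi> + \<eta>))"
    by (simp add: ac_simps)
qed (simp_all add: Endo_deg_add[OF assms(1)] Endo_deg_add[OF assms(2)]
    Endo_deg_scale[OF assms(1)] Endo_deg_scale[OF assms(2)])

lemma Endo_deg_eqI:
  assumes D: "D \<in> Endo_deg T \<xi>" and E: "E \<in> Endo_deg T \<eta>"
    and "\<And>g x. x \<in> hcomp T g \<Longrightarrow> D x = E x"
  shows "D = E"
proof
  fix x
  have "D (\<Sum>g | component T g x \<noteq> 0. component T g x) = E (\<Sum>g | component T g x \<noteq> 0. component T g x)"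
    unfolding Endo_deg_sum[OF D] Endo_deg_sum[OF E] using assms(3) component_in by (intro sum.cong) auto
  then show "D x = E x"
    using component_sum[of x, symmetric] by simp
qed

end


section \<open>Sums of maps\<close>

lemma sum_map_eq:
  assumes "finite S" "\<And>i. i \<notin> S \<Longrightarrow> F i = (\<lambda>_. 0)"
  shows "sum_map F x = (\<Sum>i\<in>S. F i x)"
  unfolding sum_map_def using assms by (intro sum.mono_neutral_left) auto

lemma finsuppI: "finite S \<Longrightarrow> (\<And>i. i \<notin> S \<Longrightarrow> F i = (\<lambda>_. 0)) \<Longrightarrow> finsupp F"
  unfolding finsupp_def by (rule finite_subset) auto

lemma finsuppE:
  assumes "finsupp F"
  obtains S where "finite S" "\<And>i. i \<notin> S \<Longrightarrow> F i = (\<lambda>_. 0)"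
  using assms unfolding finsupp_def by (rule that) blast

lemma finsupp2E:
  assumes "finsupp F" "finsupp G"
  obtains S where "finite S" "\<And>i. i \<notin> S \<Longrightarrow> F i = (\<lambda>_. 0)" "\<And>i. i \<notin> S \<Longrightarrow> G i = (\<lambda>_. 0)"
proof
  show "finite ({i. F i \<noteq> (\<lambda>_. 0)} \<union> {i. G i \<noteq> (\<lambda>_. 0)})"
    using assms by (simp add: finsupp_def)
qed blast+

lemma finsupp_single: "finsupp (\<lambda>j. if j = k then f else (\<lambda>_. 0))"
  by (rule finsuppI[of "{k}"]) auto

lemma sum_map_single: "sum_map (\<lambda>j. if j = k then f else (\<lambda>_. 0)) = f"
  by (rule ext, subst sum_map_eq[of "{k}"]) auto

lemma sum_map_zero: "sum_map (\<lambda>_ _. 0) = (\<lambda>_. 0)"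
  by (simp add: sum_map_def)

lemma dsumD: "F \<in> dsum A \<Longrightarrow> F i \<in> A i"
  by (simp add: dsum_def)

lemma dsum_finsupp: "F \<in> dsum A \<Longrightarrow> finsupp F"
  by (simp add: dsum_def)

lemma dsumI: "(\<And>i. F i \<in> A i) \<Longrightarrow> finsupp F \<Longrightarrow> F \<in> dsum A"
  by (simp add: dsum_def)

lemma dsum_single:
  assumes "f \<in> A k" "\<And>j. (\<lambda>_. 0) \<in> A j"
  shows "(\<lambda>j. if j = k then f else (\<lambda>_. 0)) \<in> dsum A"
  using assms finsupp_single by (auto simp: dsum_def)

section \<open>Independence of the spaces of maps of different degrees\<close>

context graded
begin

text \<open>The summand of degree \<xi> moves \<open>x\<close> into degree \<open>g + \<xi>\<close>,
  and different \<xi> give different target degrees. So each summand can be read off from the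
  sum.\<close>

lemma component_sum_map:
  assumes F: "F \<in> dsum (Endo_deg T)" and x: "x \<in> hcomp T g"
  shows "component T (g + \<xi>) (sum_map F x) = F \<xi> x"
proof -
  obtain S where S: "finite S" "\<And>\<xi>. \<xi> \<notin> S \<Longrightarrow> F \<xi> = (\<lambda>_. 0)"
    by (rule finsuppE[OF dsum_finsupp[OF F]]) blast
  \<comment> \<open>Indexed by the target degree \<open>h\<close>, the decomposition is
    \<open>F (h - g) x\<close>, supported in the translate of \<open>S\<close> by \<open>g\<close>;
    the claim is its entry at \<open>h = g + \<xi>\<close>.\<close>
  have "component T (g + \<xi>) (sum_map F x) = F (g + \<xi> - g) x"
  proof (rule component_eqI[where S = "(+) g ` S"])
    fix h
    have "F (h - g) x \<in> hcomp T (g + (h - g))"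
      by (rule Endo_deg_hcomp[OF dsumD[OF F] x])
    then show "F (h - g) x \<in> hcomp T h"
      by simp
    show "F (h - g) x = 0" if "h \<notin> (+) g ` S"
    proof -
      have "h - g \<notin> S"
      proof
        assume "h - g \<in> S"
        then have "g + (h - g) \<in> (+) g ` S" by blast
        with that show False by simp
      qed
      then show ?thesis by (simp add: S(2))
    qed
    show "sum_map F x = (\<Sum>h\<in>(+) g ` S. F (h - g) x)"
      using S by (subst sum.reindex) (auto simp: sum_map_eq[of S])
  qed (use S in simp)
  then show ?thesis by simp
qed

lemma sum_map_Endo_deg_inj:
  assumes "F \<in> dsum (Endo_deg T)" "G \<in> dsum (Endo_deg T)" "sum_map F = sum_map G"
  shows "F = G"
proof
  fix \<xi>
  show "F \<xi> = G \<xi>"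
    by (rule Endo_deg_eqI[OF dsumD[OF assms(1)] dsumD[OF assms(2)]])
      (simp add: component_sum_map[OF assms(1), symmetric] component_sum_map[OF assms(2), symmetric] assms(3))
qed

lemma Endo_deg_subset_Endo: "Endo_deg T \<xi> \<subseteq> Endo T"
proof
  fix D
  assume "D \<in> Endo_deg T \<xi>"
  then have "(\<lambda>\<eta>. if \<eta> = \<xi> then D else (\<lambda>_. 0)) \<in> dsum (Endo_deg T)"
    by (intro dsum_single zero_in_Endo_deg)
  then show "D \<in> Endo T"
    unfolding Endo_def by (rule rev_image_eqI) (simp only: sum_map_single)
qed

lemma Endo_add:
  assumes "D \<in> Endo T" "E \<in> Endo T"
  shows "(\<lambda>x. D x + E x) \<in> Endo T"
proof -
  obtain F G where F: "F \<in> dsum (Endo_deg T)" "D = sum_map F" and G: "G \<in> dsum (Endo_deg T)" "E = sum_map G"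
    using assms by (auto simp: Endo_def)
  obtain S where S: "finite S" "\<And>i. i \<notin> S \<Longrightarrow> F i = (\<lambda>_. 0)" "\<And>i. i \<notin> S \<Longrightarrow> G i = (\<lambda>_. 0)"
    by (rule finsupp2E[OF dsum_finsupp[OF F(1)] dsum_finsupp[OF G(1)]]) blast
  have mem: "(\<lambda>i x. F i x + G i x) \<in> dsum (Endo_deg T)"
  proof (intro dsumI Endo_degI)
    fix i
    note Fi = dsumD[OF F(1), of i] and Gi = dsumD[OF G(1), of i]
    show "F i (x + y) + G i (x + y) = F i x + G i x + (F i y + G i y)" for x y
      by (simp add: Endo_deg_add[OF Fi] Endo_deg_add[OF Gi] ac_simps)
    show "F i (smul T a x) + G i (smul T a x) = smul T a (F i x + G i x)" for a x
      by (simp add: Endo_deg_scale[OF Fi] Endo_deg_scale[OF Gi] scale_right_distrib)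
    show "F i x + G i x \<in> hcomp T (g + i)" if "x \<in> hcomp T g" for g x
      by (intro subspace_add[OF hcomp_subspace] Endo_deg_hcomp[OF Fi] Endo_deg_hcomp[OF Gi] that)
  qed (use S in \<open>auto intro: finsuppI[of S]\<close>)
  have eq: "(\<lambda>x. D x + E x) = sum_map (\<lambda>i x. F i x + G i x)"
  proof
    fix x
    have "sum_map (\<lambda>i x. F i x + G i x) x = (\<Sum>i\<in>S. F i x + G i x)"
      by (rule sum_map_eq[OF S(1)]) (simp add: S)
    then show "D x + E x = sum_map (\<lambda>i x. F i x + G i x) x"
      by (simp add: F(2) G(2) sum_map_eq[OF S(1,2)] sum_map_eq[OF S(1,3)] sum.distrib)
  qed
  show ?thesis
    unfolding Endo_def using mem eq by blast
qed

text \<open>Covers inhomogeneous summands as well, as needed for \<open>Der\<close>: only closure of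
  \<open>Endo T\<close> under addition is used, by induction over the support.\<close>

lemma sum_map_in_Endo:
  assumes "F \<in> dsum A" "\<And>i. A i \<subseteq> Endo T"
  shows "sum_map F \<in> Endo T"
proof -
  have "(\<lambda>x. \<Sum>i\<in>S. F i x) \<in> Endo T" if "finite S" for S
    using that
  proof (induction S)
    case empty
    then show ?case
      using Endo_deg_subset_Endo zero_in_Endo_deg by auto
  next
    case (insert i S)
    then show ?case
      using Endo_add[of "F i" "\<lambda>x. \<Sum>i\<in>S. F i x"] assms by (auto simp: dsum_def)
  qed
  moreover obtain S where S: "finite S" "\<And>i. i \<notin> S \<Longrightarrow> F i = (\<lambda>_. 0)"
    by (rule finsuppE[OF dsum_finsupp[OF assms(1)]]) blast
  moreover have "sum_map F = (\<lambda>x. \<Sum>i\<in>S. F i x)"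
    using sum_map_eq[OF S] by (rule ext)
  ultimately show ?thesis
    by simp
qed

lemma Der_k_subset_Endo: "Der_k V T k \<subseteq> Endo T"
proof -
  have "Der_hom V T k \<xi> \<subseteq> Endo T" for \<xi>
    using Endo_deg_subset_Endo by (auto simp: Der_hom_def)
  then show ?thesis
    using sum_map_in_Endo[of _ "Der_hom V T k"] by (auto simp: Der_k_def)
qed

lemma Der_subset_Endo: "Der V T \<subseteq> Endo T"
  using sum_map_in_Endo[of _ "Der_k V T"] Der_k_subset_Endo by (auto simp: Der_def)

text \<open>If a sum of homogeneous derivations commutes with the twist, then so does every summand,
  because the twist is even.\<close>

lemma Der_k_UNIV_Int_Comm:
  assumes "twist T \<in> Endo_deg T 0"
  shows "Der_k UNIV T k \<inter> Comm T \<subseteq> Der_k (Comm T) T k"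
proof
  fix D
  assume "D \<in> Der_k UNIV T k \<inter> Comm T"
  then obtain F where F: "F \<in> dsum (Der_hom UNIV T k)" "D = sum_map F" "D \<circ> twist T = twist T \<circ> D"
    by (auto simp: Der_k_def Comm_def)
  then have deg: "F \<xi> \<in> Endo_deg T \<xi>" for \<xi>
    by (auto simp: dsum_def Der_hom_def)
  obtain S where S: "finite S" "\<And>i. i \<notin> S \<Longrightarrow> F i = (\<lambda>_. 0)"
    by (rule finsuppE[OF dsum_finsupp[OF F(1)]]) blast
  \<comment> \<open>Both families have their \<xi>-th member in degree \<xi>, and their sums are
    \<open>D \<circ> twist T\<close> and \<open>twist T \<circ> D\<close>. Equal sums force equal
    families.\<close>
  have *: "(\<lambda>\<xi>. F \<xi> \<circ> twist T) = (\<lambda>\<xi>. twist T \<circ> F \<xi>)"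
  proof (rule sum_map_Endo_deg_inj)
    show "(\<lambda>\<xi>. F \<xi> \<circ> twist T) \<in> dsum (Endo_deg T)"
      using comp_in_Endo_deg[OF deg assms] S by (auto simp: dsum_def intro!: finsuppI[of S])
    show "(\<lambda>\<xi>. twist T \<circ> F \<xi>) \<in> dsum (Endo_deg T)"
      using comp_in_Endo_deg[OF assms deg] S
      by (auto simp: dsum_def Endo_deg_0[OF assms] intro!: finsuppI[of S])
    show "sum_map (\<lambda>\<xi>. F \<xi> \<circ> twist T) = sum_map (\<lambda>\<xi>. twist T \<circ> F \<xi>)"
    proof
      fix x
      have "sum_map (\<lambda>\<xi>. F \<xi> \<circ> twist T) x = (\<Sum>\<xi>\<in>S. F \<xi> (twist T x))"
        by (subst sum_map_eq[OF S(1)]) (auto simp: S(2))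
      also have "\<dots> = D (twist T x)"
        by (simp add: F(2) sum_map_eq[OF S])
      also have "\<dots> = twist T (D x)"
        using fun_cong[OF F(3), of x] by simp
      also have "\<dots> = (\<Sum>\<xi>\<in>S. twist T (F \<xi> x))"
        by (simp add: F(2) sum_map_eq[OF S] Endo_deg_sum[OF assms])
      also have "\<dots> = sum_map (\<lambda>\<xi>. twist T \<circ> F \<xi>) x"
        by (subst sum_map_eq[OF S(1)]) (auto simp: S(2) Endo_deg_0[OF assms])
      finally show "sum_map (\<lambda>\<xi>. F \<xi> \<circ> twist T) x = sum_map (\<lambda>\<xi>. twist T \<circ> F \<xi>) x" .
    qed
  qed
  have "F \<xi> \<in> Comm T" for \<xi>
    using fun_cong[OF *, of \<xi>] deg Endo_deg_subset_Endo by (auto simp: Comm_def)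
  then have "F \<in> dsum (Der_hom (Comm T) T k)"
    using F(1) by (auto simp: dsum_def Der_hom_def)
  then show "D \<in> Der_k (Comm T) T k"
    by (simp add: Der_k_def F(2))
qed

end


section \<open>The span of the products\<close>

locale twisted_color = graded T
  for T :: "('f::field, 'g::ab_group_add, 'a::ab_group_add) hom_color" +
  assumes color: "color_algebra T"
    and twist_even: "twist T \<in> Endo_deg T 0"
    and twist_brac: "length xs = arity T \<Longrightarrow> twist T (brac T xs) = brac T (map (twist T) xs)"
    and arity_ge_2: "2 \<le> arity T"
begin

lemma homogeneous_args_iff:
  "homogeneous_args T xs gs \<longleftrightarrow> length xs = arity T \<and> list_all2 (\<lambda>x g. x \<in> hcomp T g) xs gs"
  by (auto simp: homogeneous_args_def list_all2_conv_all_nth)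

lemma brac_hcomp: "homogeneous_args T xs gs \<Longrightarrow> brac T xs \<in> hcomp T (sum_list gs)"
  using color by (simp add: color_algebra_def)

lemma brac_sum:
  assumes "length xs + length ys + 1 = arity T"
  shows "brac T (xs @ (\<Sum>i\<in>I. f i) # ys) = (\<Sum>i\<in>I. brac T (xs @ f i # ys))"
proof -
  interpret l: Vector_Spaces.linear "smul T" "smul T" "\<lambda>x. brac T (xs @ x # ys)"
    using color assms by (simp add: color_algebra_def)
  show ?thesis by (rule l.sum)
qed

lemma brac_zero:
  assumes "length xs = arity T" "0 \<in> set xs"
  shows "brac T xs = 0"
proof -
  obtain ys zs where xs: "xs = ys @ 0 # zs"
    using split_list[OF assms(2)] by blast
  \<comment> \<open>The zero argument is viewed as an empty sum.\<close>
  then show ?thesis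
    using brac_sum[of ys zs "\<lambda>_. 0" "{}"] assms(1) by simp
qed

text \<open>The identities for quasiderivations are stated for homogeneous arguments only; this
  makes such products sufficient for arguments by linearity.\<close>

lemma products_span_homogeneous:
  "products_span T = span {brac T xs |xs gs. homogeneous_args T xs gs}"
    (is "_ = span ?H")
proof
  \<comment> \<open>The prefix \<open>hs\<close> is already homogeneous, the suffix
    \<open>ys\<close> arbitrary. Each induction step expands the first entry of the suffix into its
    parts and moves it to the prefix.\<close>
  have "brac T (hs @ ys) \<in> span ?H"
    if "list_all2 (\<lambda>x g. x \<in> hcomp T g) hs gs" "length hs + length ys = arity T" for hs gs ys
    using that
  proof (induction ys arbitrary: hs gs)
    case Nil
    then have "homogeneous_args T hs gs"
      by (simp add: homogeneous_args_iff)
    then show ?case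
      by (auto intro: span_base)
  next
    case (Cons y ys)
    let ?S = "{g. component T g y \<noteq> 0}"
    have "brac T (hs @ component T g y # ys) \<in> span ?H" for g
      using Cons.IH[of "hs @ [component T g y]" "gs @ [g]"] Cons.prems
      by (simp add: list_all2_appendI component_in)
    then have "brac T (hs @ (\<Sum>g\<in>?S. component T g y) # ys) \<in> span ?H"
      using Cons.prems by (subst brac_sum) (auto intro: span_sum)
    then show ?case
      by (simp only: component_sum[of y, symmetric])
  qed
  from this[of "[]" "[]"] show "products_span T \<subseteq> span ?H"
    unfolding products_span_def by (intro span_minimal) auto
  show "span ?H \<subseteq> products_span T"
    unfolding products_span_def by (intro span_mono) (auto simp: homogeneous_args_def)
qed

lemma subspace_products_span: "subspace (products_span T)"
  by (simp add: products_span_def)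

lemma brac_in_products_span: "length xs = arity T \<Longrightarrow> brac T xs \<in> products_span T"
  unfolding products_span_def by (auto intro: span_base)

text \<open>A product of homogeneous arguments is itself homogeneous, so its part of degree
  \<open>g\<close> is the product or \<open>0\<close>.\<close>

lemma component_products_span:
  assumes "b \<in> products_span T"
  shows "component T g b \<in> products_span T"
proof -
  have "span {brac T xs |xs gs. homogeneous_args T xs gs} \<subseteq> {b. component T g b \<in> products_span T}"
  proof (intro span_minimal subspace_Endo_deg_vimage[OF component_in_Endo_deg] subspace_products_span)
    show "{brac T xs |xs gs. homogeneous_args T xs gs} \<subseteq> {b. component T g b \<in> products_span T}"
      using subspace_0[OF subspace_products_span] brac_in_products_span
      by (auto simp: component_homogeneous[OF brac_hcomp] homogeneous_args_def)
  qed
  then show ?thesis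
    using assms unfolding products_span_homogeneous by blast
qed

lemma twist_products_span:
  assumes "b \<in> products_span T"
  shows "twist T b \<in> products_span T"
proof -
  have "products_span T \<subseteq> {b. twist T b \<in> products_span T}"
    unfolding products_span_def
  proof (intro span_minimal subspace_Endo_deg_vimage[OF twist_even] subspace_span)
    show "{brac T xs |xs. length xs = arity T}
        \<subseteq> {b. twist T b \<in> span {brac T xs |xs. length xs = arity T}}"
      by (auto simp: twist_brac intro!: span_base)
  qed
  then show ?thesis
    using assms by blast
qed


subsection \<open>Companion maps of quasiderivations\<close>

lemma
  assumes "quasi_pair_hom T k \<xi> D D'"
  shows quasi_pair_hom_left: "D \<in> Endo_deg T \<xi>"
    and quasi_pair_hom_right: "D' \<in> Endo_deg T \<xi>"
    and quasi_pair_hom_comm_left: "D (twist T x) = twist T (D x)"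
    and quasi_pair_hom_comm_right: "D' (twist T x) = twist T (D' x)"
    and quasi_pair_hom_leibniz:
      "homogeneous_args T xs gs \<Longrightarrow> D' (brac T xs) = leibniz_sum T k \<xi> D xs gs"
  using assms by (auto simp: quasi_pair_hom_def Comm_def fun_eq_iff)

text \<open>On products of homogeneous arguments both companions equal the same Leibniz sum;
  linearity extends this to the span.\<close>

lemma quasi_pair_hom_unique:
  assumes D1: "quasi_pair_hom T k \<xi> D D1" and D2: "quasi_pair_hom T k \<xi> D D2"
    and "b \<in> products_span T"
  shows "D1 b = D2 b"
proof -
  have "b \<in> span {brac T xs |xs gs. homogeneous_args T xs gs}"
    using assms(3) by (simp add: products_span_homogeneous)
  then show ?thesis
  proof (induction rule: span_induct_alt)
    case base
    show ?case
      by (simp add: Endo_deg_0[OF quasi_pair_hom_right[OF D1]] Endo_deg_0[OF quasi_pair_hom_right[OF D2]])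
  next
    case (step c x y)
    then show ?case
      by (auto simp: Endo_deg_add[OF quasi_pair_hom_right[OF D1]] Endo_deg_add[OF quasi_pair_hom_right[OF D2]]
          Endo_deg_scale[OF quasi_pair_hom_right[OF D1]] Endo_deg_scale[OF quasi_pair_hom_right[OF D2]]
          quasi_pair_hom_leibniz[OF D1] quasi_pair_hom_leibniz[OF D2])
  qed
qed

text \<open>Every term of the Leibniz sum has a zero argument. This pair fills up families outside
  their supports.\<close>

lemma quasi_pair_hom_zero: "quasi_pair_hom T k \<xi> (\<lambda>_. 0) (\<lambda>_. 0)"
proof -
  have "(\<lambda>_. 0) \<in> Comm T"
    using zero_in_Endo_deg Endo_deg_subset_Endo Endo_deg_0[OF twist_even] by (auto simp: Comm_def)
  moreover have "brac T ((map (twist T ^^ k) xs)[i := 0]) = 0"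
    if "homogeneous_args T xs gs" "i < arity T" for xs gs i
    using that by (intro brac_zero) (auto simp: homogeneous_args_def set_update_memI)
  ultimately show ?thesis
    by (auto simp: quasi_pair_hom_def zero_in_Endo_deg leibniz_sum_def)
qed

lemma quasi_pair_kE:
  assumes "quasi_pair_k T k D D'"
  obtains F F' where "F \<in> dsum (Endo_deg T)" "F' \<in> dsum (Endo_deg T)"
    "\<And>\<xi>. quasi_pair_hom T k \<xi> (F \<xi>) (F' \<xi>)" "D = sum_map F" "D' = sum_map F'"
proof -
  obtain F F' where F: "finsupp F" "finsupp F'" "\<And>\<xi>. quasi_pair_hom T k \<xi> (F \<xi>) (F' \<xi>)"
    "D = sum_map F" "D' = sum_map F'"
    using assms unfolding quasi_pair_k_def by blast
  show thesis
  proof (rule that)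
    show "F \<in> dsum (Endo_deg T)" "F' \<in> dsum (Endo_deg T)"
      using F(1,2) quasi_pair_hom_left[OF F(3)] quasi_pair_hom_right[OF F(3)] by (simp_all add: dsumI)
  qed (fact F)+
qed

lemma quasi_pair_k_unique:
  assumes D1: "quasi_pair_k T k D D1" and D2: "quasi_pair_k T k D D2"
    and b: "b \<in> products_span T"
  shows "D1 b = D2 b"
proof -
  obtain F F' where F: "F \<in> dsum (Endo_deg T)" "F' \<in> dsum (Endo_deg T)"
    "\<And>\<xi>. quasi_pair_hom T k \<xi> (F \<xi>) (F' \<xi>)" "D = sum_map F" "D1 = sum_map F'"
    using D1 by (rule quasi_pair_kE) blast
  obtain G G' where G: "G \<in> dsum (Endo_deg T)" "G' \<in> dsum (Endo_deg T)"
    "\<And>\<xi>. quasi_pair_hom T k \<xi> (G \<xi>) (G' \<xi>)" "D = sum_map G" "D2 = sum_map G'"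
    using D2 by (rule quasi_pair_kE) blast
  \<comment> \<open>The two witnesses for \<open>D\<close> come with separate decompositions; by
    independence of degrees these coincide, so companions can be compared degree by degree.\<close>
  have FG: "F = G"
    using sum_map_Endo_deg_inj[OF F(1) G(1)] F(4) G(4) by simp
  obtain S where S: "finite S" "\<And>i. i \<notin> S \<Longrightarrow> F' i = (\<lambda>_. 0)" "\<And>i. i \<notin> S \<Longrightarrow> G' i = (\<lambda>_. 0)"
    by (rule finsupp2E[OF dsum_finsupp[OF F(2)] dsum_finsupp[OF G(2)]]) blast
  have "F' \<xi> b = G' \<xi> b" for \<xi>
    using quasi_pair_hom_unique[OF F(3) _ b] G(3) by (simp add: FG)
  then show ?thesis
    by (simp add: F(5) G(5) sum_map_eq[OF S(1,2)] sum_map_eq[OF S(1,3)])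
qed

lemma quasi_pair_k_zero: "quasi_pair_k T k (\<lambda>_. 0) (\<lambda>_. 0)"
  unfolding quasi_pair_k_def
  by (intro exI[of _ "\<lambda>_ _. 0"]) (auto simp: sum_map_zero finsupp_def quasi_pair_hom_zero)

lemma quasi_pair_k_comm:
  assumes "quasi_pair_k T k D D'"
  shows "D (twist T x) = twist T (D x)" "D' (twist T x) = twist T (D' x)"
proof -
  obtain F F' where F: "F \<in> dsum (Endo_deg T)" "F' \<in> dsum (Endo_deg T)"
    "\<And>\<xi>. quasi_pair_hom T k \<xi> (F \<xi>) (F' \<xi>)" "D = sum_map F" "D' = sum_map F'"
    using assms by (rule quasi_pair_kE) blast
  obtain S where S: "finite S" "\<And>i. i \<notin> S \<Longrightarrow> F i = (\<lambda>_. 0)" "\<And>i. i \<notin> S \<Longrightarrow> F' i = (\<lambda>_. 0)"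
    by (rule finsupp2E[OF dsum_finsupp[OF F(1)] dsum_finsupp[OF F(2)]]) blast
  show "D (twist T x) = twist T (D x)"
    by (simp add: F(4) sum_map_eq[OF S(1,2)] Endo_deg_sum[OF twist_even] quasi_pair_hom_comm_left[OF F(3)])
  show "D' (twist T x) = twist T (D' x)"
    by (simp add: F(5) sum_map_eq[OF S(1,3)] Endo_deg_sum[OF twist_even] quasi_pair_hom_comm_right[OF F(3)])
qed

lemma QDer_k_pair_exists:
  assumes "D \<in> QDer_k T k"
  shows "\<exists>D'. quasi_pair_k T k D D'"
proof -
  obtain F where F: "F \<in> dsum (QDer_hom T k)" "D = sum_map F"
    using assms by (auto simp: QDer_k_def)
  obtain S where S: "finite S" "\<And>i. i \<notin> S \<Longrightarrow> F i = (\<lambda>_. 0)"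
    by (rule finsuppE[OF dsum_finsupp[OF F(1)]]) blast
  have "\<forall>\<xi>. \<exists>D'. quasi_pair_hom T k \<xi> (F \<xi>) D'"
    using dsumD[OF F(1)] by (simp add: QDer_hom_def)
  then obtain F' where F': "\<And>\<xi>. quasi_pair_hom T k \<xi> (F \<xi>) (F' \<xi>)"
    by metis
  \<comment> \<open>Companions chosen where \<open>F \<xi>\<close> vanishes need not vanish
    themselves. Resetting them to zero makes the family finitely supported.\<close>
  let ?F' = "\<lambda>\<xi>. if \<xi> \<in> S then F' \<xi> else (\<lambda>_. 0)"
  have "quasi_pair_hom T k \<xi> (F \<xi>) (?F' \<xi>)" for \<xi>
    using F' S(2) quasi_pair_hom_zero by simp
  moreover have "finsupp ?F'"
    by (rule finsuppI[OF S(1)]) simp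
  ultimately show ?thesis
    using dsum_finsupp[OF F(1)] F(2) unfolding quasi_pair_k_def by blast
qed

lemma quasi_pair_k_imp_QDer_k: "quasi_pair_k T k D D' \<Longrightarrow> D \<in> QDer_k T k"
  by (auto simp: quasi_pair_k_def QDer_k_def QDer_hom_def dsum_def)

lemma QDer_pair_exists:
  assumes "D \<in> QDer T"
  shows "\<exists>D'. quasi_pair T D D'"
proof -
  have D: "D \<in> dsum (QDer_k T)"
    using assms by (simp add: QDer_def)
  obtain S where S: "finite S" "\<And>k. k \<notin> S \<Longrightarrow> D k = (\<lambda>_. 0)"
    by (rule finsuppE[OF dsum_finsupp[OF D]]) blast
  obtain D' where D': "\<And>k. quasi_pair_k T k (D k) (D' k)"
    using QDer_k_pair_exists[OF dsumD[OF D]] by metis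
  \<comment> \<open>Finite support in \<open>k\<close> is restored in the same way.\<close>
  let ?D' = "\<lambda>k. if k \<in> S then D' k else (\<lambda>_. 0)"
  have "quasi_pair_k T k (D k) (?D' k)" for k
    using D' S(2) quasi_pair_k_zero by simp
  moreover have "finsupp ?D'"
    by (rule finsuppI[OF S(1)]) simp
  ultimately show ?thesis
    using dsum_finsupp[OF D] unfolding quasi_pair_def by blast
qed

lemma
  assumes "quasi_pair T D D'"
  shows quasi_pair_finsupp_left: "finsupp D"
    and quasi_pair_finsupp_right: "finsupp D'"
    and quasi_pair_at: "quasi_pair_k T k (D k) (D' k)"
  using assms by (simp_all add: quasi_pair_def)

text \<open>Both companions belong to the same family \<open>D\<close>, so uniqueness applies for
  each \<open>k\<close> before summing.\<close>

lemma quasi_pair_unique: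
  assumes D1: "quasi_pair T D D1" and D2: "quasi_pair T D D2"
    and b: "b \<in> products_span T"
  shows "sum_map D1 b = sum_map D2 b"
proof -
  obtain S where S: "finite S" "\<And>i. i \<notin> S \<Longrightarrow> D1 i = (\<lambda>_. 0)" "\<And>i. i \<notin> S \<Longrightarrow> D2 i = (\<lambda>_. 0)"
    by (rule finsupp2E[OF quasi_pair_finsupp_right[OF D1] quasi_pair_finsupp_right[OF D2]]) blast
  have "D1 k b = D2 k b" for k
    by (rule quasi_pair_k_unique[OF quasi_pair_at[OF D1] quasi_pair_at[OF D2] b])
  then show ?thesis
    by (simp add: sum_map_eq[OF S(1,2)] sum_map_eq[OF S(1,3)])
qed

end


section \<open>The projection onto the span of the products\<close>

text \<open>The description occurring inside \<open>phi_via\<close>, named so that it can be treated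
  as a linear map.\<close>

definition proj ::
  "('f::field, 'g::ab_group_add, 'a::ab_group_add) hom_color \<Rightarrow> 'a set \<Rightarrow> 'a \<Rightarrow> 'a" where
  "proj T U y = (THE b. b \<in> products_span T \<and> (\<exists>u \<in> U. y = u + b))"

locale split_products = twisted_color T
  for T :: "('f::field, 'g::ab_group_add, 'a::ab_group_add) hom_color" +
  fixes U :: "'a set"
  assumes graded_U: "graded_subspace T U"
    and complement_U: "complement_of_products T U"
begin

lemma subspace_U: "subspace U"
  using graded_U by (simp add: graded_subspace_def)

lemma U_Int_products: "x \<in> U \<Longrightarrow> x \<in> products_span T \<Longrightarrow> x = 0"
  using complement_U by (auto simp: complement_of_products_def)

text \<open>The difference of two decompositions lies in \<open>U\<close> and in
  \<open>products_span T\<close>, hence is zero.\<close>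

lemma proj_eqI:
  assumes "u \<in> U" "b \<in> products_span T"
  shows "proj T U (u + b) = b"
  unfolding proj_def
proof (rule the_equality)
  fix b'
  assume "b' \<in> products_span T \<and> (\<exists>u'\<in>U. u + b = u' + b')"
  then obtain u' where b': "b' \<in> products_span T" "u' \<in> U" "u + b = u' + b'"
    by blast
  have "u - u' = b' - b"
    using b'(3) by (simp add: algebra_simps)
  moreover have "u - u' \<in> U"
    using assms b' by (intro subspace_diff[OF subspace_U])
  moreover have "b' - b \<in> products_span T"
    using assms b' by (intro subspace_diff[OF subspace_products_span])
  ultimately have "b' - b = 0"
    by (intro U_Int_products) simp_all
  then show "b' = b" by simp
qed (use assms in auto)

lemma proj_decomp:
  obtains u where "u \<in> U" "y = u + proj T U y" "proj T U y \<in> products_span T"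
proof -
  obtain u b where "u \<in> U" "b \<in> products_span T" "y = u + b"
    using complement_U unfolding complement_of_products_def by metis
  then show thesis
    using that proj_eqI by simp
qed

lemma proj_products: "b \<in> products_span T \<Longrightarrow> proj T U b = b"
  using proj_eqI[OF subspace_0[OF subspace_U], of b] by simp

lemma proj_in: "proj T U y \<in> products_span T"
  using proj_decomp[of y] by blast

lemma proj_in_Endo_deg: "proj T U \<in> Endo_deg T 0"
proof (rule Endo_degI)
  fix x y
  obtain u v where u: "u \<in> U" "x = u + proj T U x" and v: "v \<in> U" "y = v + proj T U y"
    using proj_decomp by metis
  have "x + y = (u + v) + (proj T U x + proj T U y)"
    by (subst u(2), subst v(2)) (simp add: ac_simps)
  then show "proj T U (x + y) = proj T U x + proj T U y"
    using proj_eqI[OF subspace_add[OF subspace_U u(1) v(1)]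
        subspace_add[OF subspace_products_span proj_in[of x] proj_in[of y]]] by simp
next
  fix a x
  obtain u where u: "u \<in> U" "x = u + proj T U x"
    using proj_decomp by metis
  have "smul T a x = smul T a u + smul T a (proj T U x)"
    by (subst u(2)) (simp add: scale_right_distrib)
  then show "proj T U (smul T a x) = smul T a (proj T U x)"
    using proj_eqI[OF subspace_scale[OF subspace_U u(1)]
        subspace_scale[OF subspace_products_span proj_in[of x]]] by simp
next
  fix g x
  assume x: "x \<in> hcomp T g"
  obtain u where u: "u \<in> U" "x = u + proj T U x"
    using proj_decomp by metis
  let ?b = "proj T U x"
  \<comment> \<open>Both summands are graded, so taking parts of degree \<open>g\<close> in
    \<open>x = u + ?b\<close> yields another decomposition of \<open>x\<close>; uniqueness
    identifies the two.\<close>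
  have "component T g ?b = ?b"
  proof -
    have "x = component T g u + component T g ?b"
      using x u(2) Endo_deg_add[OF component_in_Endo_deg, of g u ?b]
      by (simp add: component_homogeneous)
    then show ?thesis
      using proj_eqI[OF graded_subspace_component[OF graded_U u(1)]
          component_products_span[OF proj_in[of x]], of g g] by simp
  qed
  then show "?b \<in> hcomp T (g + 0)"
    using component_in[of g ?b] by simp
qed

lemma proj_twist:
  assumes "twist T ` U \<subseteq> U"
  shows "proj T U (twist T x) = twist T (proj T U x)"
proof -
  obtain u where u: "u \<in> U" "x = u + proj T U x"
    using proj_decomp by metis
  have "twist T x = twist T u + twist T (proj T U x)"
    by (subst u(2)) (rule Endo_deg_add[OF twist_even])
  then show ?thesis
    using u(1) assms proj_eqI[of "twist T u", OF _ twist_products_span[OF proj_in[of x]]] by auto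
qed

end


section \<open>The algebra on pairs\<close>

lemma breve_simps [simp]:
  "smul (breve T) c p = (smul T c (fst p), smul T c (snd p))"
  "arity (breve T) = arity T"
  "bichar (breve T) = bichar T"
  "hcomp (breve T) g = hcomp T g \<times> hcomp T g"
  "twist (breve T) p = (twist T (fst p), twist T (snd p))"
  by (simp_all add: breve_def split_beta)

lemma fst_funpow_twist_breve: "fst ((twist (breve T) ^^ k) p) = (twist T ^^ k) (fst p)"
  by (induction k) auto

text \<open>Homogeneous parts are taken in each coordinate.\<close>

lemma (in graded) graded_breve: "graded (breve T)"
proof -
  interpret b: vector_space "smul (breve T)"
    by unfold_locales (auto simp: scale_right_distrib scale_left_distrib)
  have "b.subspace (hcomp T g \<times> hcomp T g)" for g
    using hcomp_subspace[of g] by (auto simp: b.subspace_def subspace_def zero_prod_def)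
  moreover have "\<exists>!c. (\<forall>g. c g \<in> hcomp T g \<times> hcomp T g) \<and> finite {g. c g \<noteq> 0} \<and>
    p = (\<Sum>g | c g \<noteq> 0. c g)" for p
  proof (rule ex1I)
    let ?c = "\<lambda>g. (component T g (fst p), component T g (snd p))"
    let ?S = "{g. component T g (fst p) \<noteq> 0} \<union> {g. component T g (snd p) \<noteq> 0}"
    have S: "{g. ?c g \<noteq> 0} = ?S"
      by (auto simp: zero_prod_def)
    have fin: "finite ?S"
      by (simp add: finite_component)
    have "fst p = (\<Sum>g\<in>?S. component T g (fst p))" "snd p = (\<Sum>g\<in>?S. component T g (snd p))"
      by (intro component_sum_superset[OF fin]; simp)+
    then have "p = (\<Sum>g\<in>?S. ?c g)"
      by (simp add: prod_eq_iff fst_sum snd_sum)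
    then show "(\<forall>g. ?c g \<in> hcomp T g \<times> hcomp T g) \<and> finite {g. ?c g \<noteq> 0} \<and> p = (\<Sum>g | ?c g \<noteq> 0. ?c g)"
      unfolding S using fin component_in by blast
    fix c
    assume c: "(\<forall>g. c g \<in> hcomp T g \<times> hcomp T g) \<and> finite {g. c g \<noteq> 0} \<and> p = (\<Sum>g | c g \<noteq> 0. c g)"
    then have p: "p = (\<Sum>g | c g \<noteq> 0. c g)" and fin: "finite {g. c g \<noteq> 0}" by blast+
    \<comment> \<open>Each coordinate of a decomposition of \<open>p\<close> decomposes that
      coordinate of \<open>p\<close>, with support inside that of \<open>c\<close>.\<close>
    have "component T g (fst p) = fst (c g)" "component T g (snd p) = snd (c g)" for g
      using c arg_cong[OF p, of fst] arg_cong[OF p, of snd]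
      by (intro component_eqI[OF _ fin]; auto simp: fst_sum snd_sum mem_Times_iff)+
    then show "c = ?c" by auto
  qed
  ultimately show ?thesis
    using b.vector_space_axioms by (simp add: graded_def graded_space_def)
qed

context twisted_color
begin

sublocale breve: graded "breve T"
  by (rule graded_breve)

lemma twist_breve_even: "twist (breve T) \<in> Endo_deg (breve T) 0"
  by (rule breve.Endo_degI)
    (auto simp: Endo_deg_add[OF twist_even] Endo_deg_scale[OF twist_even]
      intro: Endo_deg_hcomp[OF twist_even, of _ g for g, simplified])

end


section \<open>The map phi\<close>

lemma phi_via_eq: "phi_via T U D D' p = (D (fst p), D' (proj T U (snd p)))"
  by (simp add: phi_via_def proj_def split_beta)

lemma
  assumes "finsupp F" "finsupp F'"
  shows finsupp_phi_via: "finsupp (\<lambda>i. phi_via T U (F i) (F' i))"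
    and phi_via_sum_map:
      "phi_via T U (sum_map F) (sum_map F') = sum_map (\<lambda>i. phi_via T U (F i) (F' i))"
proof -
  obtain S where S: "finite S" "\<And>i. i \<notin> S \<Longrightarrow> F i = (\<lambda>_. 0)" "\<And>i. i \<notin> S \<Longrightarrow> F' i = (\<lambda>_. 0)"
    by (rule finsupp2E[OF assms]) blast
  have zero: "phi_via T U (F i) (F' i) = (\<lambda>_. 0)" if "i \<notin> S" for i
    using S(2,3)[OF that] by (simp add: fun_eq_iff phi_via_eq zero_prod_def)
  show "finsupp (\<lambda>i. phi_via T U (F i) (F' i))"
    using S(1) zero by (rule finsuppI)
  show "phi_via T U (sum_map F) (sum_map F') = sum_map (\<lambda>i. phi_via T U (F i) (F' i))"
    \<comment> \<open>A common finite set \<open>S\<close> serves both coordinates. The index may be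
      a degree or the exponent \<open>k\<close>; both uses occur below.\<close>
    by (simp add: fun_eq_iff sum_map_eq[OF S(1) zero] phi_via_eq
        sum_map_eq[OF S(1,2)] sum_map_eq[OF S(1,3)] sum_prod)
qed

context split_products
begin

lemma phi_via_in_Endo_deg:
  assumes "D \<in> Endo_deg T \<xi>" "D' \<in> Endo_deg T \<xi>"
  shows "phi_via T U D D' \<in> Endo_deg (breve T) \<xi>"
proof (rule breve.Endo_degI)
  note simps = phi_via_eq Endo_deg_add[OF assms(1)] Endo_deg_scale[OF assms(1)]
    Endo_deg_add[OF assms(2)] Endo_deg_scale[OF assms(2)]
    Endo_deg_add[OF proj_in_Endo_deg] Endo_deg_scale[OF proj_in_Endo_deg]
  show "phi_via T U D D' (x + y) = phi_via T U D D' x + phi_via T U D D' y" for x y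
    by (simp add: simps)
  show "phi_via T U D D' (smul (breve T) a x) = smul (breve T) a (phi_via T U D D' x)" for a x
    by (simp add: simps)
  show "phi_via T U D D' x \<in> hcomp (breve T) (g + \<xi>)" if "x \<in> hcomp (breve T) g" for g x
    using that Endo_deg_hcomp[OF assms(1)] Endo_deg_hcomp[OF assms(2)]
      Endo_deg_hcomp[OF proj_in_Endo_deg, of _ g]
    by (auto simp: phi_via_eq)
qed

text \<open>Taken over \<open>UNIV\<close>, since commuting with the twist also involves the
  position of \<open>U\<close> and is treated separately.\<close>

lemma phi_via_in_Der_hom:
  assumes pair: "quasi_pair_hom T k \<xi> D D'"
  shows "phi_via T U D D' \<in> Der_hom UNIV (breve T) k \<xi>"
proof -
  note D = quasi_pair_hom_left[OF pair] and D' = quasi_pair_hom_right[OF pair]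
  let ?\<phi> = "phi_via T U D D'"
  have "?\<phi> (brac (breve T) ps) = leibniz_sum (breve T) k \<xi> ?\<phi> ps gs"
    if "homogeneous_args (breve T) ps gs" for ps gs
  proof -
    have len: "length ps = arity T" and args: "homogeneous_args T (map fst ps) gs"
      using that by (auto simp: homogeneous_args_def)
    \<comment> \<open>A product of pairs has first entry \<open>0\<close> and second entry in
      \<open>products_span T\<close>, where \<open>proj\<close> is the identity.\<close>
    have "?\<phi> (brac (breve T) ps) = (D 0, D' (brac T (map fst ps)))"
      using len arity_ge_2
      by (simp add: brac_breve phi_via_eq proj_products brac_in_products_span)
    also have "\<dots> = (0, leibniz_sum T k \<xi> D (map fst ps) gs)"
      by (simp add: Endo_deg_0[OF D] quasi_pair_hom_leibniz[OF pair args])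
    also have "\<dots> = leibniz_sum (breve T) k \<xi> ?\<phi> ps gs"
    proof -
      have "smul (breve T) c (brac (breve T) ((map (twist (breve T) ^^ k) ps)[i := ?\<phi> (ps ! i)])) =
          (0, smul T c (brac T ((map (twist T ^^ k) (map fst ps))[i := D (map fst ps ! i)])))"
        if "i < arity T" for i c
      proof -
        \<comment> \<open>The product sees only first entries, on which \<open>?\<phi>\<close> acts
          as \<open>D\<close> and the twist of pairs as \<open>twist T\<close>.\<close>
        have "map fst ((map (twist (breve T) ^^ k) ps)[i := ?\<phi> (ps ! i)]) =
            (map (twist T ^^ k) (map fst ps))[i := D (map fst ps ! i)]"
          using that len by (simp add: map_update fst_funpow_twist_breve phi_via_eq comp_def)
        then show ?thesis
          using len arity_ge_2 by (simp add: brac_breve del: list.map_comp)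
      qed
      then show ?thesis
        by (simp add: leibniz_sum_def sum_prod del: breve_simps(1))
    qed
    finally show ?thesis .
  qed
  then show ?thesis
    by (simp add: Der_hom_def phi_via_in_Endo_deg[OF D D'])
qed

lemma phi_via_in_Der_k:
  assumes "quasi_pair_k T k D D'"
  shows "phi_via T U D D' \<in> Der_k UNIV (breve T) k"
proof -
  obtain F F' where F: "finsupp F" "finsupp F'" "\<And>\<xi>. quasi_pair_hom T k \<xi> (F \<xi>) (F' \<xi>)"
    "D = sum_map F" "D' = sum_map F'"
    using assms unfolding quasi_pair_k_def by blast
  have "(\<lambda>\<xi>. phi_via T U (F \<xi>) (F' \<xi>)) \<in> dsum (Der_hom UNIV (breve T) k)"
    by (intro dsumI phi_via_in_Der_hom F(3) finsupp_phi_via F(1,2))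
  then show ?thesis
    by (simp add: Der_k_def F(4,5) phi_via_sum_map[OF F(1,2)])
qed

section \<open>Independence of \<open>phi\<close> from the companion map\<close>

lemma phi_via_cong:
  assumes "\<And>b. b \<in> products_span T \<Longrightarrow> D1 b = D2 b"
  shows "phi_via T U D D1 = phi_via T U D D2"
  using assms[OF proj_in] by (simp add: fun_eq_iff phi_via_eq)

text \<open>The given \<open>D'\<close> shows that the \<open>SOME\<close> in \<open>phi\<close>
  selects a companion, and two companions agree on the range of \<open>proj\<close>.\<close>

lemma phi_eq:
  assumes "quasi_pair T D D'"
  shows "phi T U D = phi_via T U (sum_map D) (sum_map D')"
  unfolding phi_def
  using someI[of "quasi_pair T D", OF assms] assms by (intro phi_via_cong) (rule quasi_pair_unique)

lemma phi_eq_sum_map: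
  assumes "quasi_pair T D D'"
  shows "phi T U D = sum_map (\<lambda>k. phi_via T U (D k) (D' k))"
  unfolding phi_eq[OF assms]
  by (intro phi_via_sum_map quasi_pair_finsupp_left[OF assms] quasi_pair_finsupp_right[OF assms])

lemma phi_at:
  assumes "quasi_pair_k T k D D'"
  shows "phi T U (\<lambda>j. if j = k then D else (\<lambda>_. 0)) = phi_via T U D D'"
proof -
  have "quasi_pair T (\<lambda>j. if j = k then D else (\<lambda>_. 0)) (\<lambda>j. if j = k then D' else (\<lambda>_. 0))"
    using assms quasi_pair_k_zero by (simp add: quasi_pair_def finsupp_single)
  from phi_eq[OF this] show ?thesis
    by (simp only: sum_map_single)
qed

lemma QDer_at_eq: "D \<in> QDer_at T k \<Longrightarrow> D = (\<lambda>j. if j = k then D k else (\<lambda>_. 0))"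
  by (auto simp: QDer_at_def)

section \<open>Values of \<open>phi\<close> as derivations and as commuting maps\<close>

lemma phi_in_Der_k:
  assumes "D \<in> QDer_at T k"
  shows "phi T U D \<in> Der_k UNIV (breve T) k"
proof -
  have "D k \<in> QDer_k T k"
    using assms by (simp add: QDer_at_def QDer_def dsum_def)
  then obtain D' where pair: "quasi_pair_k T k (D k) D'"
    using QDer_k_pair_exists by blast
  show ?thesis
    by (subst QDer_at_eq[OF assms], subst phi_at[OF pair]) (rule phi_via_in_Der_k[OF pair])
qed

lemma phi_in_Der:
  assumes "D \<in> QDer T"
  shows "phi T U D \<in> Der UNIV (breve T)"
proof -
  obtain D' where pair: "quasi_pair T D D'"
    using QDer_pair_exists[OF assms] by blast
  then have "(\<lambda>k. phi_via T U (D k) (D' k)) \<in> dsum (Der_k UNIV (breve T))"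
    by (intro dsumI phi_via_in_Der_k finsupp_phi_via quasi_pair_at)
      (simp_all add: quasi_pair_def)
  then show ?thesis
    unfolding phi_eq_sum_map[OF pair] Der_def by (rule imageI)
qed

lemma phi_in_Der_Comm:
  assumes "phi T U ` QDer T \<subseteq> Comm (breve T)" "D \<in> QDer T"
  shows "phi T U D \<in> Der (Comm (breve T)) (breve T)"
proof -
  obtain D' where pair: "quasi_pair T D D'"
    using QDer_pair_exists[OF assms(2)] by blast
  have "phi_via T U (D k) (D' k) \<in> Der_k (Comm (breve T)) (breve T) k" for k
  proof -
    note k = quasi_pair_at[OF pair, of k]
    \<comment> \<open>The hypothesis on \<open>phi\<close> is applied to the family concentrated at
      \<open>k\<close>, which shows that each single summand commutes with the twist.\<close>
    have "(\<lambda>j. if j = k then D k else (\<lambda>_. 0)) \<in> QDer T"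
      unfolding QDer_def
      using quasi_pair_k_imp_QDer_k[OF k] quasi_pair_k_imp_QDer_k[OF quasi_pair_k_zero]
      by (rule dsum_single)
    then have "phi_via T U (D k) (D' k) \<in> Comm (breve T)"
      using assms(1) phi_at[OF k] by auto
    then show ?thesis
      using breve.Der_k_UNIV_Int_Comm[OF twist_breve_even] phi_via_in_Der_k[OF k] by auto
  qed
  then have "(\<lambda>k. phi_via T U (D k) (D' k)) \<in> dsum (Der_k (Comm (breve T)) (breve T))"
    by (intro dsumI finsupp_phi_via quasi_pair_finsupp_left[OF pair] quasi_pair_finsupp_right[OF pair])
  then show ?thesis
    unfolding phi_eq_sum_map[OF pair] Der_def by (rule imageI)
qed

lemma phi_in_Comm:
  assumes "twist T ` U \<subseteq> U" "D \<in> QDer T"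
  shows "phi T U D \<in> Comm (breve T)"
proof -
  obtain D' where pair: "quasi_pair T D D'"
    using QDer_pair_exists[OF assms(2)] by blast
  obtain S where S: "finite S" "\<And>i. i \<notin> S \<Longrightarrow> D i = (\<lambda>_. 0)" "\<And>i. i \<notin> S \<Longrightarrow> D' i = (\<lambda>_. 0)"
    by (rule finsupp2E[OF quasi_pair_finsupp_left[OF pair] quasi_pair_finsupp_right[OF pair]]) blast
  have "sum_map D (twist T x) = twist T (sum_map D x)"
    "sum_map D' (twist T x) = twist T (sum_map D' x)" for x
    by (simp_all add: sum_map_eq[OF S(1,2)] sum_map_eq[OF S(1,3)] Endo_deg_sum[OF twist_even]
        quasi_pair_k_comm[OF quasi_pair_at[OF pair]])
  then have "phi T U D \<circ> twist (breve T) = twist (breve T) \<circ> phi T U D"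
    by (simp add: fun_eq_iff phi_eq[OF pair] phi_via_eq proj_twist[OF assms(1)])
  then show ?thesis
    using breve.Der_subset_Endo phi_in_Der[OF assms(2)] by (auto simp: Comm_def)
qed

text \<open>A homogeneous \<open>D\<close> may come with an inhomogeneous companion map, but the components of
  the latter in other degrees vanish on products.\<close>

lemma phi_even:
  assumes "D \<in> QDer T" "\<And>k. D k \<in> Endo_deg T \<xi>"
  shows "phi T U D \<in> Endo_deg (breve T) \<xi>"
proof -
  obtain D' where pair: "quasi_pair T D D'"
    using QDer_pair_exists[OF assms(1)] by blast
  have deg: "phi_via T U (D k) (D' k) \<in> Endo_deg (breve T) \<xi>" for k
  proof -
    obtain F F' where F: "F \<in> dsum (Endo_deg T)" "F' \<in> dsum (Endo_deg T)"
      "\<And>\<xi>. quasi_pair_hom T k \<xi> (F \<xi>) (F' \<xi>)" "D k = sum_map F" "D' k = sum_map F'"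
      using quasi_pair_at[OF pair, of k] by (rule quasi_pair_kE) blast
    \<comment> \<open>Since \<open>D k\<close> has degree \<xi>, independence of degrees
      concentrates its decomposition at \<xi>.\<close>
    have single: "F = (\<lambda>\<eta>. if \<eta> = \<xi> then D k else (\<lambda>_. 0))"
    proof (rule sum_map_Endo_deg_inj[OF F(1)])
      show "(\<lambda>\<eta>. if \<eta> = \<xi> then D k else (\<lambda>_. 0)) \<in> dsum (Endo_deg T)"
        using assms(2) zero_in_Endo_deg by (rule dsum_single)
    qed (simp only: sum_map_single F(4))
    obtain S where S: "finite S" "\<And>i. i \<notin> S \<Longrightarrow> F' i = (\<lambda>_. 0)"
      by (rule finsuppE[OF dsum_finsupp[OF F(2)]]) blast
    have "D' k b = F' \<xi> b" if "b \<in> products_span T" for b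
    proof -
      \<comment> \<open>Here \<open>F \<eta>\<close> is zero, so \<open>F' \<eta>\<close> and the
        zero map are both companions of zero.\<close>
      have "F' \<eta> b = 0" if "\<eta> \<noteq> \<xi>" for \<eta>
        using F(3)[of \<eta>] that single
        by (intro quasi_pair_hom_unique[OF _ quasi_pair_hom_zero \<open>b \<in> products_span T\<close>, of k \<eta>]) simp
      \<comment> \<open>The degree \<xi> is inserted because it may lie outside
        \<open>S\<close>.\<close>
      moreover have "D' k b = (\<Sum>\<eta>\<in>insert \<xi> S. F' \<eta> b)"
        unfolding F(5) using S by (intro sum_map_eq) auto
      moreover have "(\<Sum>\<eta>\<in>insert \<xi> S. F' \<eta> b) = (\<Sum>\<eta>\<in>{\<xi>}. F' \<eta> b)"
        using S(1) calculation(1) by (intro sum.mono_neutral_right) auto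
      ultimately show ?thesis by simp
    qed
    then have "phi_via T U (D k) (D' k) = phi_via T U (D k) (F' \<xi>)"
      by (rule phi_via_cong)
    then show ?thesis
      using phi_via_in_Endo_deg[OF assms(2) dsumD[OF F(2)]] by simp
  qed
  have fin: "finsupp (\<lambda>k. phi_via T U (D k) (D' k))"
    by (intro finsupp_phi_via quasi_pair_finsupp_left[OF pair] quasi_pair_finsupp_right[OF pair])
  obtain S where S: "finite S" "\<And>k. k \<notin> S \<Longrightarrow> phi_via T U (D k) (D' k) = (\<lambda>_. 0)"
    using fin by (rule finsuppE) blast
  have "phi T U D = (\<lambda>p. \<Sum>k\<in>S. phi_via T U (D k) (D' k) p)"
    unfolding phi_eq_sum_map[OF pair] by (rule ext) (rule sum_map_eq[OF S])
  then show ?thesis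
    using breve.sum_in_Endo_deg[OF deg] by simp
qed

text \<open>The first entry of \<open>phi T U D (a, 0)\<close> is \<open>sum_map D a\<close>, so the
  underlying maps are recovered.\<close>

lemma phi_inj:
  assumes "D \<in> QDer T" "E \<in> QDer T" "phi T U D = phi T U E"
  shows "sum_map D = sum_map E"
proof
  fix a
  obtain D' E' where "quasi_pair T D D'" "quasi_pair T E E'"
    using QDer_pair_exists assms(1,2) by metis
  then show "sum_map D a = sum_map E a"
    using fun_cong[OF assms(3), of "(a, 0)"] by (simp add: phi_eq phi_via_eq)
qed

text \<open>A family concentrated at one \<open>k\<close> is determined by its sum.\<close>

lemma inj_on_phi_QDer_at: "inj_on (phi T U) (QDer_at T k)"
proof (rule inj_onI)
  fix D E
  assume D: "D \<in> QDer_at T k" and E: "E \<in> QDer_at T k" and "phi T U D = phi T U E"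
  then have "sum_map D = sum_map E"
    by (intro phi_inj) (auto simp: QDer_at_def)
  then have "D k = E k"
    by (subst (asm) QDer_at_eq[OF D], subst (asm) QDer_at_eq[OF E]) (simp only: sum_map_single)
  then show "D = E"
    by (subst QDer_at_eq[OF D], subst QDer_at_eq[OF E]) (simp only:)
qed

end

theorem theorem25:
  fixes T :: "('f::field, 'g::ab_group_add, 'a::ab_group_add) hom_color"
    and \<Omega> :: "'f hpoly set"
    and U :: "'a set"
  assumes "hom_omega_color_algebra \<Omega> T"
    and "2 \<le> arity T"
    and "graded_subspace T U"
    and "complement_of_products T U"
  shows
    "(\<comment> \<open>phi maps into the endomorphisms and is even\<close>
      phi T U ` QDer T \<subseteq> Endo (breve T) \<and>
      (\<forall>\<xi>. \<forall>D \<in> QDer T. (\<forall>k. D k \<in> Endo_deg T \<xi>) \<longrightarrow> phi T U D \<in> Endo_deg (breve T) \<xi>)) \<and>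
     (\<comment> \<open>phi is given by the defining formula, for every choice of D'\<close>
      (\<forall>D \<in> QDer T. \<exists>D'. quasi_pair T D D') \<and>
      (\<forall>D \<in> QDer T. \<forall>D'. quasi_pair T D D' \<longrightarrow>
         (\<forall>a. \<forall>u \<in> U. \<forall>b \<in> products_span T.
            phi T U D (a, u + b) = (sum_map D a, sum_map D' b))) \<and>
      \<comment> \<open>injectivity, as linear maps and on each summand\<close>
      (\<forall>D \<in> QDer T. \<forall>E \<in> QDer T. phi T U D = phi T U E \<longrightarrow> sum_map D = sum_map E) \<and>
      (\<forall>k. inj_on (phi T U) (QDer_at T k))) \<and>
     (\<comment> \<open>the values are derivations\<close>
      phi T U ` QDer T \<subseteq> Der UNIV (breve T) \<and>
      (\<forall>k. phi T U ` QDer_at T k \<subseteq> Der_k UNIV (breve T) k) \<and>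
      \<comment> \<open>the same when only maps commuting with the twisting map count; the values of phi
         commute with it for instance if U is invariant\<close>
      (\<forall>k. phi T U ` QDer_at T k \<inter> Comm (breve T) \<subseteq> Der_k (Comm (breve T)) (breve T) k) \<and>
      (phi T U ` QDer T \<subseteq> Comm (breve T) \<longrightarrow>
         phi T U ` QDer T \<subseteq> Der (Comm (breve T)) (breve T)) \<and>
      (twist T ` U \<subseteq> U \<longrightarrow> phi T U ` QDer T \<subseteq> Comm (breve T)))"
proof -
  interpret split_products T U
  proof
    show "graded_space T" "color_algebra T" "twist T \<in> Endo_deg T 0"
      "\<And>xs. length xs = arity T \<Longrightarrow> twist T (brac T xs) = brac T (map (twist T) xs)"
      using assms(1) by (auto simp: hom_omega_color_algebra_def color_algebra_def)
  qed (fact assms)+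
  show ?thesis
  proof (intro conjI allI ballI impI)
    show "phi T U ` QDer T \<subseteq> Endo (breve T)"
      using breve.Der_subset_Endo phi_in_Der by blast
    show "phi T U D (a, u + b) = (sum_map D a, sum_map D' b)"
      if "quasi_pair T D D'" "u \<in> U" "b \<in> products_span T" for D D' a u b
      using that by (simp add: phi_eq phi_via_eq proj_eqI)
    show "phi T U ` QDer_at T k \<inter> Comm (breve T) \<subseteq> Der_k (Comm (breve T)) (breve T) k" for k
      using breve.Der_k_UNIV_Int_Comm[OF twist_breve_even] phi_in_Der_k by blast
    show "phi T U D \<in> Endo_deg (breve T) \<xi>"
      if "D \<in> QDer T" "\<forall>k. D k \<in> Endo_deg T \<xi>" for D \<xi>
      using that by (simp add: phi_even)
    show "sum_map D = sum_map E" if "D \<in> QDer T" "E \<in> QDer T" "phi T U D = phi T U E" for D E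
      using that by (rule phi_inj)
  qed (simp_all add: image_subset_iff QDer_pair_exists inj_on_phi_QDer_at phi_in_Der phi_in_Der_k
      phi_in_Der_Comm phi_in_Comm)
qed

end
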